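(* Let $\{X(t)\}_{t\ge 0}$ be a process governed by $$\mathrm{d}X(t)=[a_{\theta_1,\theta_2,\theta_3}(t)+b_{\theta_2,\theta_3}(t)X(t)]\,\mathrm{d}t+\sigma_{\theta_3}(t)\,\mathrm{d}W(t),\qquad X(0)=X_0\in\mathbb{R}\ \text{fixed},$$ under the assumptions stated in the context, and let $\overline{\mathcal{T}_{n,\mathcal{D}}}$ be the closure of $\mathcal{T}_{n,\mathcal{D}}$ in $\mathbb{R}^n$. If $\tau_0\in\overline{\mathcal{T}_{n,\mathcal{D}}}$, then there exists a feasible design $\tau\in\mathcal{T}_{n,\mathcal{D}}$ such that $$\mathscr{I}(\tau,\theta^* )\succeq_{\mathrm{L}}\mathscr{I}(\tau_0,\theta^* ).$$
   Context: Model: $W$ is a one-dimensional Wiener process; the parameters are $\theta_1\in\mathbb{R}^{m_1}$, $\theta_2\in\mathbb{R}^{m_2}$, $\theta_3\in\mathbb{R}$, and the (nonrandom) initial value $X_0\in\mathbb{R}$, which does not appear in $a$, $b$, $\sigma$. Put $\theta=(X_0,\theta_1^{\mathsf T},\theta_2^{\mathsf T},\theta_3)^{\mathsf T}$ and $m=\dim(\theta)$. The functions $a(t)$, $b(t)$, $\sigma^2(t)$ are differentiable with respect to $\theta$ and integrable with respect to $t$, and $\sigma(t)$ is positive almost everywhere with respect to Lebesgue measure. Designs: $0<T_*<T^*$, $\mathcal{D}=[T_*,T^*]$, $\mathcal{T}_{n,\mathcal{D}}=\{\tau=(t_1,\dots,t_n)\in\mathbb{R}^n: T_*\le t_1<\dots<t_n\le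 T^*\}$, with $n\ge m$. Elements of $\mathcal{T}_{n,\mathcal{D}}$ are called feasible designs. Fisher information: $\mathscr{I}(\tau,\theta^* )$ is the $m\times m$ Fisher information matrix about $\theta$, at $\theta=\theta^*$ (a given parameter value), contained in the Gaussian vector $X(\tau)=(X(t_1),\dots,X(t_n))^{\mathsf T}$. With $\Sigma(\tau)$ the covariance matrix of $X(\tau)$ and $\tau\in\mathcal{T}_{n,\mathcal{D}}$, its entries, for scalar components $\alpha,\beta$ of $\theta$, are $$\{\mathscr{I}(\tau,\theta^* )\}_{\alpha\beta}=\left(\frac{\partial \mathcal{E}[X(\tau)]^{\mathsf T}}{\partial\alpha}\Sigma^{-1}(\tau)\frac{\partial \mathcal{E}[X(\tau)]}{\partial\beta}\right)\Big|_{\theta^*}+\frac12\mathrm{tr}\left\{\Sigma^{-1}(\tau)\frac{\partial\Sigma(\tau)}{\partial\alpha}\Sigma^{-1}(\tau)\frac{\partial\Sigma(\tau)}{\partial\beta}\right\}\Big|_{\theta^*},$$ where $\mathcal{E}$ denotes expectation. For a design in $\overline{\mathcal{T}_{n,\mathcal{D}}}$ with repeated times, a repeated observation of $X(t)$ given $X(t)$ is deterministic and carries zero information, so $\mathscr{I}(\tau_0,\theta^* )$ is the Fisher information matrix of the observations at the distinct times occurring in $\tau_0$ (given by the same formula). $A\succeq_{\mathrm L}B$ means that $A-B$ is symmetric non-negative definite (Loewner ordering). *)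

theory Defs
  imports
    "HOL-Probability.Probability"
    "Jordan_Normal_Form.Gauss_Jordan_Elimination"
begin

(* Both Finite_Cartesian_Product (types real ^ 'n) and Jordan_Normal_Form.Matrix (sizes that
   are natural numbers) are in use.  The infix $ is left to the former; the latter's
   vectors and the HOL-Analysis functions on matrices are written by qualified name where
   they clash. *)
no_notation vec_index (infixl "$" 100)

definition wiener_process :: "'w measure \<Rightarrow> (real \<Rightarrow> 'w \<Rightarrow> real) \<Rightarrow> bool" where
  "wiener_process M W \<longleftrightarrow>
     prob_space M \<and>
     (\<forall>t\<ge>0. W t \<in> borel_measurable M) \<and>
     (AE \<omega> in M. W 0 \<omega> = 0) \<and>
     (\<forall>n (t :: nat \<Rightarrow> real). 0 \<le> t 0 \<longrightarrow> mono t \<longrightarrow>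
        prob_space.indep_vars M (\<lambda>_. borel) (\<lambda>i \<omega>. W (t (Suc i)) \<omega> - W (t i) \<omega>) {..<n}) \<and>
     (\<forall>s t. 0 \<le> s \<longrightarrow> s < t \<longrightarrow>
        distributed M lborel (\<lambda>\<omega>. W t \<omega> - W s \<omega>) (normal_density 0 (sqrt (t - s)))) \<and>
     (AE \<omega> in M. continuous_on {0..} (\<lambda>t. W t \<omega>))"

(* Step functions with values c 0, ..., c (n - 1) on the intervals (p i, p (i + 1)]. *)
definition step_fun :: "nat \<Rightarrow> (nat \<Rightarrow> real) \<Rightarrow> (nat \<Rightarrow> real) \<Rightarrow> real \<Rightarrow> real" where
  "step_fun n p c s = (\<Sum>i<n. c i * indicator {p i<..p (Suc i)} s)"

definition step_integral ::
  "(real \<Rightarrow> 'w \<Rightarrow> real) \<Rightarrow> nat \<Rightarrow> (nat \<Rightarrow> real) \<Rightarrow> (nat \<Rightarrow> real) \<Rightarrow> 'w \<Rightarrow> real" where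
  "step_integral W n p c \<omega> = (\<Sum>i<n. c i * (W (p (Suc i)) \<omega> - W (p i) \<omega>))"

(* Z is a version of the stochastic integral of the nonrandom function f with respect to W
   over [0, t]: the mean-square limit of the integrals of step functions that converge to f
   in L2[0, t].  By the Ito isometry Z does not depend (up to null sets) on the chosen step
   functions. *)
definition has_wiener_integral ::
  "'w measure \<Rightarrow> (real \<Rightarrow> 'w \<Rightarrow> real) \<Rightarrow> (real \<Rightarrow> real) \<Rightarrow> real \<Rightarrow> ('w \<Rightarrow> real) \<Rightarrow> bool" where
  "has_wiener_integral M W f t Z \<longleftrightarrow>
     Z \<in> borel_measurable M \<and>
     (\<exists>(n :: nat \<Rightarrow> nat) (p :: nat \<Rightarrow> nat \<Rightarrow> real) (c :: nat \<Rightarrow> nat \<Rightarrow> real).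
        (\<forall>k. mono_on {..n k} (p k) \<and> p k ` {..n k} \<subseteq> {0..t}) \<and>
        (\<lambda>k. \<integral>\<^sup>+ s. ennreal ((f s - step_fun (n k) (p k) (c k) s)\<^sup>2) \<partial>lebesgue_on {0..t})
           \<longlonglongrightarrow> 0 \<and>
        (\<lambda>k. \<integral>\<^sup>+ \<omega>. ennreal ((Z \<omega> - step_integral W (n k) (p k) (c k) \<omega>)\<^sup>2) \<partial>M)
           \<longlonglongrightarrow> 0)"

(* X solves dX = (a + b X) dt + \<sigma> dW, X(0) = x0, in the integrated sense.  Adaptedness to
   the filtration of W is not required: the noise is additive with nonrandom coefficients,
   so the equation is solved path by path and determines X from W. *)
definition solves_linear_sde ::
  "'w measure \<Rightarrow> (real \<Rightarrow> 'w \<Rightarrow> real) \<Rightarrow> (real \<Rightarrow> real) \<Rightarrow> (real \<Rightarrow> real) \<Rightarrow> (real \<Rightarrow> real)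
     \<Rightarrow> real \<Rightarrow> (real \<Rightarrow> 'w \<Rightarrow> real) \<Rightarrow> bool" where
  "solves_linear_sde M W a b \<sigma> x0 X \<longleftrightarrow>
     (\<forall>t\<ge>0. X t \<in> borel_measurable M) \<and>
     (AE \<omega> in M. continuous_on {0..} (\<lambda>t. X t \<omega>)) \<and>
     (\<forall>t\<ge>0. \<exists>Z. has_wiener_integral M W \<sigma> t Z \<and>
        (AE \<omega> in M. X t \<omega> = x0 + (LINT s:{0..t}|lebesgue. a s + b s * X s \<omega>) + Z \<omega>))"

(* Index type of the scalar components of \<theta> = (X0, \<theta>1, \<theta>2, \<theta>3). *)
datatype ('p, 'q) component = Init | Par1 'p | Par2 'q | Par3

lemma UNIV_component: "UNIV = {Init, Par3} \<union> range Par1 \<union> range Par2"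
proof -
  have "x \<in> {Init, Par3} \<union> range Par1 \<union> range Par2" for x :: "('p, 'q) component"
    by (cases x) auto
  then show ?thesis by blast
qed

instance component :: (finite, finite) finite
  by standard (simp add: UNIV_component)

lemma card_component: "CARD(('p::finite, 'q::finite) component) = CARD('p) + CARD('q) + 2"
proof -
  have "card (range (Par1 :: 'p \<Rightarrow> ('p, 'q) component)) = CARD('p)"
    and "card (range (Par2 :: 'q \<Rightarrow> ('p, 'q) component)) = CARD('q)"
    by (auto intro!: card_image injI)
  moreover have "card ({Init, Par3} \<union> range (Par1 :: 'p \<Rightarrow> ('p, 'q) component)) =
      card {Init, Par3 :: ('p, 'q) component} + card (range (Par1 :: 'p \<Rightarrow> ('p, 'q) component))"
    by (rule card_Un_disjoint) auto
  moreover have "CARD(('p, 'q) component) =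
      card ({Init, Par3} \<union> range (Par1 :: 'p \<Rightarrow> ('p, 'q) component))
        + card (range (Par2 :: 'q \<Rightarrow> ('p, 'q) component))"
    unfolding UNIV_component by (rule card_Un_disjoint) auto
  ultimately show ?thesis by simp
qed

type_synonym ('p, 'q) parameter = "real ^ ('p, 'q) component"

definition init :: "('p::finite, 'q::finite) parameter \<Rightarrow> real" where
  "init \<theta> = \<theta> $ Init"

definition par1 :: "('p::finite, 'q::finite) parameter \<Rightarrow> real ^ 'p" where
  "par1 \<theta> = (\<chi> i. \<theta> $ Par1 i)"

definition par2 :: "('p::finite, 'q::finite) parameter \<Rightarrow> real ^ 'q" where
  "par2 \<theta> = (\<chi> i. \<theta> $ Par2 i)"

definition par3 :: "('p::finite, 'q::finite) parameter \<Rightarrow> real" where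
  "par3 \<theta> = \<theta> $ Par3"

(* If the derivative does not exist, this is an unspecified value determined by the function
   h \<mapsto> f (\<theta> + h e\<^sub>\<alpha>) alone. *)
definition partial_deriv :: "'i::finite \<Rightarrow> (real ^ 'i \<Rightarrow> real) \<Rightarrow> real ^ 'i \<Rightarrow> real" where
  "partial_deriv \<alpha> f \<theta> = deriv (\<lambda>h. f (\<theta> + h *\<^sub>R axis \<alpha> 1)) 0"

definition mean_fun :: "'w measure \<Rightarrow> (real \<Rightarrow> 'w \<Rightarrow> real) \<Rightarrow> real \<Rightarrow> real" where
  "mean_fun M X t = prob_space.expectation M (X t)"

definition cov_fun :: "'w measure \<Rightarrow> (real \<Rightarrow> 'w \<Rightarrow> real) \<Rightarrow> real \<Rightarrow> real \<Rightarrow> real" where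
  "cov_fun M X s t =
     prob_space.expectation M (\<lambda>\<omega>. (X s \<omega> - mean_fun M X s) * (X t \<omega> - mean_fun M X t))"

definition mat_trace :: "real mat \<Rightarrow> real" where
  "mat_trace A = (\<Sum>i<dim_row A. A $$ (i, i))"

(* Fisher information about \<theta> in the Gaussian vector (X \<theta> t1, ..., X \<theta> tk), where ts is the
   list of the observation times t1, ..., tk and X \<theta> is the process under the parameter \<theta>. *)
definition gaussian_information ::
  "'w measure \<Rightarrow> (real ^ 'i \<Rightarrow> real \<Rightarrow> 'w \<Rightarrow> real) \<Rightarrow> real list \<Rightarrow> real ^ 'i \<Rightarrow> real ^ 'i::finite ^ 'i" where
  "gaussian_information M X ts \<theta> = (\<chi> \<alpha> \<beta>.
     let k = length ts;
         d\<mu> = (\<lambda>\<gamma>. Matrix.vec k (\<lambda>i. partial_deriv \<gamma> (\<lambda>\<eta>. mean_fun M (X \<eta>) (ts ! i)) \<theta>));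
         d\<Sigma> = (\<lambda>\<gamma>. Matrix.mat k k
                  (\<lambda>(i, j). partial_deriv \<gamma> (\<lambda>\<eta>. cov_fun M (X \<eta>) (ts ! i) (ts ! j)) \<theta>));
         \<Sigma> = Matrix.mat k k (\<lambda>(i, j). cov_fun M (X \<theta>) (ts ! i) (ts ! j));
         \<Sigma>inv = the (mat_inverse \<Sigma>)
     in scalar_prod (d\<mu> \<alpha>) (mult_mat_vec \<Sigma>inv (d\<mu> \<beta>))
        + 1 / 2 * mat_trace (\<Sigma>inv * d\<Sigma> \<alpha> * \<Sigma>inv * d\<Sigma> \<beta>))"

definition feasible_designs :: "real \<Rightarrow> real \<Rightarrow> (real ^ 'n::{finite,linorder}) set" where
  "feasible_designs T\<^sub>l T\<^sub>u = {\<tau>. strict_mono (vec_nth \<tau>) \<and> (\<forall>i. \<tau> $ i \<in> {T\<^sub>l..T\<^sub>u})}"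

(* The distinct times occurring in a design. *)
definition design_times :: "real ^ 'n::finite \<Rightarrow> real list" where
  "design_times \<tau> = sorted_list_of_set (range (vec_nth \<tau>))"

lemma design_times_feasible:
  fixes \<tau> :: "real ^ 'n::{finite,linorder}"
  assumes "\<tau> \<in> feasible_designs T\<^sub>l T\<^sub>u"
  shows "design_times \<tau> = map (vec_nth \<tau>) (sorted_list_of_set UNIV)"
proof -
  have sm: "strict_mono (vec_nth \<tau>)"
    using assms by (simp add: feasible_designs_def)
  let ?l = "map (vec_nth \<tau>) (sorted_list_of_set UNIV)"
  have "sorted ?l"
    using sm by (auto simp: sorted_map intro!: sorted_wrt_mono_rel[OF _ sorted_sorted_list_of_set]
        dest: strict_mono_less_eq)
  moreover have "distinct ?l"
    using sm by (simp add: distinct_map strict_mono_imp_inj_on inj_on_subset)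
  moreover have "set ?l = range (vec_nth \<tau>)"
    by simp
  ultimately have "sorted_list_of_set (range (vec_nth \<tau>)) = ?l"
    by (metis sorted_list_of_set.idem_if_sorted_distinct)
  then show ?thesis by (simp add: design_times_def)
qed

definition fisher_information ::
  "'w measure \<Rightarrow> (real ^ 'i \<Rightarrow> real \<Rightarrow> 'w \<Rightarrow> real) \<Rightarrow> real ^ 'n::finite \<Rightarrow> real ^ 'i
     \<Rightarrow> real ^ 'i::finite ^ 'i" where
  "fisher_information M X \<tau> \<theta> = gaussian_information M X (design_times \<tau>) \<theta>"

definition loewner_ge :: "real ^ 'i::finite ^ 'i \<Rightarrow> real ^ 'i ^ 'i \<Rightarrow> bool" where
  "loewner_ge A B \<longleftrightarrow>
     Finite_Cartesian_Product.transpose (A - B) = A - B \<and> (\<forall>v. 0 \<le> inner v ((A - B) *v v))"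

end

theory Submission
  imports Defs "Jordan_Normal_Form.Determinant"
begin

text \<open>
  The information matrix of the observations at a finite set of times is built from the mean,
  the covariance and their parameter derivatives at these times. The theorem therefore follows
  from two facts: every \<open>\<tau>\<^sub>0\<close> in the closure has at most \<open>n\<close> distinct times, all in the design
  interval, so that they are among the times of some feasible \<open>\<tau>\<close> (\<open>feasible_refinement\<close>); and the
  information grows with the set of observation times (\<open>gaussian_information_monotone\<close>).

  Monotonicity is linear algebra. In a direction \<open>v\<close> the quadratic form of the information is
  \<open>x \<bullet> P x + tr (P S P S) / 2\<close>, where \<open>P\<close> is the inverse of the covariance \<open>C\<close>, and \<open>x\<close> and \<open>S\<close> are the
  derivatives of mean and covariance in the direction \<open>v\<close>. Let \<open>R\<close> be the inverse of the block of \<open>C\<close>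
  that belongs to fewer times, padded with zeros. Then \<open>R C R = P C R = R C P = R\<close>, so \<open>Q = P - R\<close>
  satisfies \<open>Q C Q = Q\<close> and is nonnegative definite. The two quadratic forms differ by
  \<open>x \<bullet> Q x + (tr (Q S P S) + tr (R S Q S)) / 2\<close>. A trace \<open>tr (A S B S)\<close> with \<open>A\<close> nonnegative definite and
  \<open>B = B C B\<close> is the expectation of \<open>\<eta> \<bullet> A \<eta>\<close> with \<open>\<eta> = S B \<xi>\<close>, where \<open>\<xi>\<close> is a random vector with
  covariance \<open>C\<close>; hence the difference is nonnegative for every vector \<open>x\<close> and every symmetric \<open>S\<close>
  (\<open>information_monotone\<close>).

  It remains to see that the covariance of \<open>X\<close> at finitely many positive times exists and is
  invertible. Put \<open>f t = X t - \<integral>\<^sub>0\<^sup>t b X\<close>; up to a deterministic term this is the Wiener integral of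
  \<open>\<sigma>\<close> over \<open>[0, t]\<close>. A pathwise Gronwall inequality bounds \<open>\<integral> \<bar>b X\<bar>\<close> by a multiple of \<open>\<integral> \<bar>b f\<bar>\<close>, which
  makes \<open>X t\<close> square integrable. For invertibility, let \<open>N = W t - W w\<close> with \<open>w < t\<close>. The function
  \<open>h s = E (N X s)\<close> solves \<open>h = g + \<integral> b h\<close>, where \<open>g s\<close> is the integral of \<open>\<sigma>\<close> over the part of \<open>(w, t]\<close>
  below \<open>s\<close>. The same Gronwall inequality shows \<open>h = 0\<close> up to time \<open>w\<close>, and \<open>h t > 0\<close> once \<open>w\<close> is close to \<open>t\<close>
  (\<open>volterra_nondegenerate\<close>). Such an \<open>N\<close> is correlated with \<open>X t\<close> but with no value of \<open>X\<close> up to time \<open>w\<close>, so a linear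
  combination of values of \<open>X\<close> whose centred version vanishes almost surely has no last nonzero
  coefficient (\<open>covariance_nondegenerate\<close>).
\<close>

(* The infix $ selects components of vectors in real ^ 'n. *)
no_notation vec_index (infixl "$" 100)

section \<open>Arrays over a finite index set\<close>

text \<open>Matrices are represented by functions on all of the index type together with the finite set
  \<open>J\<close> over which products and traces are summed. Passing to fewer observation times then only
  changes \<open>J\<close>, and a principal submatrix needs no reindexing.\<close>

definition mprod :: "'t set \<Rightarrow> ('t \<Rightarrow> 't \<Rightarrow> real) \<Rightarrow> ('t \<Rightarrow> 't \<Rightarrow> real) \<Rightarrow> 't \<Rightarrow> 't \<Rightarrow> real" where
  "mprod J A B s u = (\<Sum>t\<in>J. A s t * B t u)"

definition mtrace :: "'t set \<Rightarrow> ('t \<Rightarrow> 't \<Rightarrow> real) \<Rightarrow> real" where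
  "mtrace J A = (\<Sum>s\<in>J. A s s)"

definition bform :: "'t set \<Rightarrow> ('t \<Rightarrow> 't \<Rightarrow> real) \<Rightarrow> ('t \<Rightarrow> real) \<Rightarrow> ('t \<Rightarrow> real) \<Rightarrow> real" where
  "bform J A x y = (\<Sum>s\<in>J. \<Sum>t\<in>J. A s t * (x s * y t))"

lemma mprod_assoc: "mprod J (mprod J A B) D = mprod J A (mprod J B D)"
  unfolding mprod_def
  by (intro ext) (simp add: sum_distrib_left sum_distrib_right mult.assoc, rule sum.swap)

lemma mtrace_commute: "mtrace J (mprod J A B) = mtrace J (mprod J B A)"
  unfolding mprod_def mtrace_def by (subst sum.swap) (simp add: mult.commute)

lemma mprod_diff_left: "mprod J (\<lambda>s t. A s t - B s t) D = (\<lambda>s t. mprod J A D s t - mprod J B D s t)"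
  by (simp add: mprod_def fun_eq_iff left_diff_distrib sum_subtractf)

lemma mprod_diff_right: "mprod J D (\<lambda>s t. A s t - B s t) = (\<lambda>s t. mprod J D A s t - mprod J D B s t)"
  by (simp add: mprod_def fun_eq_iff right_diff_distrib sum_subtractf)

lemma mtrace_diff: "mtrace J (\<lambda>s t. A s t - B s t) = mtrace J A - mtrace J B"
  by (simp add: mtrace_def sum_subtractf)

lemma mprod_transpose:
  assumes "\<And>s t. A s t = A t s" "\<And>s t. B s t = B t s"
  shows "mprod J A B s t = mprod J B A t s"
  unfolding mprod_def using assms by (metis (no_types, lifting) mult.commute)

text \<open>Symmetric reflexive generalised inverses. Both the inverse of \<open>C\<close> and the zero-padded
  inverse of one of its principal blocks are of this kind, and so is their difference.\<close>

definition reflexive_inverse ::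
  "'t set \<Rightarrow> ('t \<Rightarrow> 't \<Rightarrow> real) \<Rightarrow> ('t \<Rightarrow> 't \<Rightarrow> real) \<Rightarrow> bool" where
  "reflexive_inverse J C B \<longleftrightarrow> (\<forall>s t. B s t = B t s) \<and> mprod J (mprod J B C) B = B"

text \<open>\<open>C\<close> is given as a Gram matrix of square integrable functions, so that its nonnegativity, and
  that of traces involving it, is read off from integrals of squares.\<close>

locale gram =
  fixes M :: "'w measure" and \<xi> :: "'t \<Rightarrow> 'w \<Rightarrow> real" and J :: "'t set" and C
  assumes fin: "finite J"
    and int: "\<And>s t. s \<in> J \<Longrightarrow> t \<in> J \<Longrightarrow> integrable M (\<lambda>\<omega>. \<xi> s \<omega> * \<xi> t \<omega>)"
    and C: "\<And>s t. s \<in> J \<Longrightarrow> t \<in> J \<Longrightarrow> C s t = (\<integral>\<omega>. \<xi> s \<omega> * \<xi> t \<omega> \<partial>M)"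
begin

lemma expectation_comb_prod:
  "(\<integral>\<omega>. (\<Sum>v\<in>J. x v * \<xi> v \<omega>) * (\<Sum>w\<in>J. y w * \<xi> w \<omega>) \<partial>M) = bform J C x y" (is ?th1)
  "integrable M (\<lambda>\<omega>. (\<Sum>v\<in>J. x v * \<xi> v \<omega>) * (\<Sum>w\<in>J. y w * \<xi> w \<omega>))" (is ?th2)
proof -
  have eq: "(\<lambda>\<omega>. (\<Sum>v\<in>J. x v * \<xi> v \<omega>) * (\<Sum>w\<in>J. y w * \<xi> w \<omega>))
    = (\<lambda>\<omega>. \<Sum>v\<in>J. \<Sum>w\<in>J. (x v * y w) * (\<xi> v \<omega> * \<xi> w \<omega>))"
    by (simp add: sum_product mult_ac)
  show ?th2 unfolding eq by (intro Bochner_Integration.integrable_sum integrable_mult_right int)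
  have "(\<integral>\<omega>. (\<Sum>v\<in>J. \<Sum>w\<in>J. (x v * y w) * (\<xi> v \<omega> * \<xi> w \<omega>)) \<partial>M)
    = (\<Sum>v\<in>J. (\<integral>\<omega>. (\<Sum>w\<in>J. (x v * y w) * (\<xi> v \<omega> * \<xi> w \<omega>)) \<partial>M))"
    by (intro Bochner_Integration.integral_sum Bochner_Integration.integrable_sum
        integrable_mult_right int)
  also have "\<dots> = (\<Sum>v\<in>J. \<Sum>w\<in>J. (\<integral>\<omega>. (x v * y w) * (\<xi> v \<omega> * \<xi> w \<omega>) \<partial>M))"
    by (intro sum.cong[OF refl] Bochner_Integration.integral_sum integrable_mult_right int)
  also have "\<dots> = bform J C x y"
    unfolding bform_def by (intro sum.cong[OF refl]) (simp add: C)
  finally show ?th1 unfolding eq .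
qed

lemma bform_nonneg: "0 \<le> bform J C x x"
  unfolding expectation_comb_prod(1)[symmetric] by simp

text \<open>From \<open>B = B C B\<close> and symmetry: \<open>x \<bullet> B x = (B x) \<bullet> C (B x)\<close>.\<close>

lemma bform_reflexive_inverse:
  assumes "reflexive_inverse J C B"
  shows "bform J B x x = bform J C (\<lambda>t. \<Sum>s\<in>J. x s * B s t) (\<lambda>t. \<Sum>s\<in>J. x s * B s t)"
proof -
  have sym: "B s t = B t s" for s t using assms unfolding reflexive_inverse_def by blast
  have BCB: "B s t = (\<Sum>v\<in>J. (\<Sum>u\<in>J. B s u * C u v) * B t v)" for s t
  proof -
    have "B s t = mprod J (mprod J B C) B s t"
      using assms by (simp add: reflexive_inverse_def)
    then show ?thesis unfolding mprod_def by (simp only: sym[of _ t])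
  qed
  have "bform J B x x = (\<Sum>s\<in>J. \<Sum>t\<in>J. (\<Sum>v\<in>J. (\<Sum>u\<in>J. B s u * C u v) * B t v) * (x s * x t))"
    unfolding bform_def by (intro sum.cong[OF refl]) (simp flip: BCB)
  also have "\<dots> = (\<Sum>s\<in>J. \<Sum>t\<in>J. \<Sum>v\<in>J. \<Sum>u\<in>J. C u v * ((x s * B s u) * (x t * B t v)))"
    by (simp add: sum_distrib_right sum_distrib_left mult_ac)
  also have "\<dots> = (\<Sum>t\<in>J. \<Sum>v\<in>J. \<Sum>s\<in>J. \<Sum>u\<in>J. C u v * ((x s * B s u) * (x t * B t v)))"
    by (subst sum.swap, rule sum.cong[OF refl], rule sum.swap)
  also have "\<dots> = (\<Sum>v\<in>J. \<Sum>t\<in>J. \<Sum>u\<in>J. \<Sum>s\<in>J. C u v * ((x s * B s u) * (x t * B t v)))"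
    by (subst sum.swap, rule sum.cong[OF refl], rule sum.cong[OF refl], rule sum.swap)
  also have "\<dots> = (\<Sum>v\<in>J. \<Sum>u\<in>J. \<Sum>t\<in>J. \<Sum>s\<in>J. C u v * ((x s * B s u) * (x t * B t v)))"
    by (rule sum.cong[OF refl], rule sum.swap)
  also have "\<dots> = (\<Sum>u\<in>J. \<Sum>v\<in>J. C u v * ((\<Sum>s\<in>J. x s * B s u) * (\<Sum>t\<in>J. x t * B t v)))"
    by (rule trans[OF sum.swap], rule sum.cong[OF refl], rule sum.cong[OF refl])
       (rule trans[OF sum.swap], simp only: sum_product, simp only: sum_distrib_left)
  finally show ?thesis unfolding bform_def .
qed

lemma bform_reflexive_inverse_nonneg: "reflexive_inverse J C B \<Longrightarrow> 0 \<le> bform J B x x"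
  by (simp add: bform_reflexive_inverse bform_nonneg)

text \<open>Since \<open>S B S = (S B) C (S B)\<^sup>T\<close> is the second moment matrix of \<open>\<eta> = S B \<xi>\<close>, the trace equals
  the integral of \<open>\<eta> \<bullet> A \<eta>\<close>, which is nonnegative pointwise.\<close>

lemma trace_nonneg:
  assumes A: "\<And>x. 0 \<le> bform J A x x" and B: "reflexive_inverse J C B"
    and S: "\<And>s t. S s t = S t s"
  shows "0 \<le> mtrace J (mprod J (mprod J (mprod J A S) B) S)"
proof -
  define E where "E = mprod J S B"
  have sym: "B s t = B t s" for s t using B unfolding reflexive_inverse_def by blast
  have "mprod J (mprod J (mprod J A S) B) S = mprod J A (mprod J E (mprod J C (mprod J B S)))"
  proof -
    have "mprod J (mprod J (mprod J A S) B) S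
        = mprod J (mprod J (mprod J A S) (mprod J (mprod J B C) B)) S"
      using B unfolding reflexive_inverse_def by simp
    then show ?thesis by (simp add: E_def mprod_assoc)
  qed
  also have "mprod J E (mprod J C (mprod J B S)) t s = bform J C (E t) (E s)" for s t
    unfolding bform_def mprod_def[of J E] mprod_def[of J C]
      mprod_transpose[of B S, OF sym S] E_def[symmetric]
    by (simp add: sum_distrib_left mult_ac)
  hence "mprod J E (mprod J C (mprod J B S)) = (\<lambda>t s. bform J C (E t) (E s))"
    by (intro ext)
  finally have eq0: "mprod J (mprod J (mprod J A S) B) S = mprod J A (\<lambda>t s. bform J C (E t) (E s))" .
  have eq: "mtrace J (mprod J (mprod J (mprod J A S) B) S)
      = (\<Sum>s\<in>J. \<Sum>t\<in>J. A s t * bform J C (E t) (E s))"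
    unfolding eq0 by (simp only: mtrace_def mprod_def)
  define \<eta> where "\<eta> t \<omega> = (\<Sum>v\<in>J. E t v * \<xi> v \<omega>)" for t \<omega>
  have "(\<Sum>s\<in>J. \<Sum>t\<in>J. A s t * bform J C (E t) (E s))
      = (\<integral>\<omega>. bform J A (\<lambda>s. \<eta> s \<omega>) (\<lambda>s. \<eta> s \<omega>) \<partial>M)"
    unfolding bform_def[of J A] \<eta>_def
    apply (subst Bochner_Integration.integral_sum)
     apply (intro Bochner_Integration.integrable_sum integrable_mult_right expectation_comb_prod(2))
    apply (intro sum.cong[OF refl])
    apply (subst Bochner_Integration.integral_sum)
     apply (intro integrable_mult_right expectation_comb_prod(2))
    apply (intro sum.cong[OF refl])
    apply (simp add: expectation_comb_prod(1)) 
    apply (subst expectation_comb_prod(1)[symmetric])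
    apply (subst expectation_comb_prod(1)[symmetric])
    apply (simp add: mult.commute)
    done
  also have "\<dots> \<ge> 0" by (simp add: A)
  finally show ?thesis using eq by simp
qed

text \<open>The difference \<open>Q = P - R\<close> is again a reflexive inverse, and telescoping gives
  \<open>tr (P S P S) - tr (R S R S) = tr (Q S P S) + tr (R S Q S)\<close>.\<close>

lemma information_monotone:
  assumes P: "reflexive_inverse J C P" and R: "reflexive_inverse J C R"
    and PR: "mprod J (mprod J P C) R = R" and RP: "mprod J (mprod J R C) P = R"
    and S: "\<And>s t. S s t = S t s"
  shows "bform J R x x + 1 / 2 * mtrace J (mprod J (mprod J (mprod J R S) R) S)
     \<le> bform J P x x + 1 / 2 * mtrace J (mprod J (mprod J (mprod J P S) P) S)"
proof -
  define Q where "Q = (\<lambda>s t. P s t - R s t)"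
  have Q: "reflexive_inverse J C Q"
    using P R PR RP unfolding reflexive_inverse_def Q_def
    by (simp add: mprod_diff_left mprod_diff_right)
  have "bform J P x x - bform J R x x = bform J Q x x"
    unfolding bform_def Q_def by (simp add: sum_subtractf left_diff_distrib)
  hence 1: "bform J R x x \<le> bform J P x x" 
    using bform_reflexive_inverse_nonneg[OF Q, of x] by simp
  let ?t = "\<lambda>A B. mtrace J (mprod J (mprod J (mprod J A S) B) S)"
  have "?t P P - ?t R R = (?t P P - ?t R P) + (?t R P - ?t R R)" by simp
  also have "\<dots> = ?t Q P + ?t R Q"
    unfolding Q_def by (simp add: mprod_diff_left mprod_diff_right mtrace_diff)
  also have "\<dots> \<ge> 0"
    by (intro add_nonneg_nonneg trace_nonneg bform_reflexive_inverse_nonneg P Q R S)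
  finally show ?thesis using 1 by simp
qed

end

lemma mprod_unit_left:
  assumes "finite J" and "\<And>s t. s \<in> J \<Longrightarrow> t \<in> J \<Longrightarrow> D s t = (if s = t then 1 else 0)"
    and "\<And>s t. s \<notin> J \<Longrightarrow> D s t = 0" and "\<And>s t. s \<notin> J \<Longrightarrow> A s t = 0"
  shows "mprod J D A = A"
proof (intro ext)
  fix s u
  show "mprod J D A s u = A s u"
  proof (cases "s \<in> J")
    case True
    have "mprod J D A s u = (\<Sum>t\<in>J. if s = t then A t u else 0)"
      unfolding mprod_def by (intro sum.cong) (auto simp: assms(2) True)
    then show ?thesis using True assms(1) by simp
  qed (simp add: mprod_def assms(3,4))
qed

lemma mprod_unit_right:
  assumes "finite J" and "\<And>s t. s \<in> J \<Longrightarrow> t \<in> J \<Longrightarrow> D s t = (if s = t then 1 else 0)"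
    and "\<And>s t. t \<notin> J \<Longrightarrow> D s t = 0" and "\<And>s t. t \<notin> J \<Longrightarrow> A s t = 0"
  shows "mprod J A D = A"
proof (intro ext)
  fix s u
  show "mprod J A D s u = A s u"
  proof (cases "u \<in> J")
    case True
    have "mprod J A D s u = (\<Sum>t\<in>J. if t = u then A s t else 0)"
      unfolding mprod_def by (intro sum.cong) (auto simp: assms(2) True)
    then show ?thesis using True assms(1) by simp
  qed (simp add: mprod_def assms(3,4))
qed

lemma mprod_support:
  assumes "finite J" "J0 \<subseteq> J" "\<And>s t. t \<notin> J0 \<Longrightarrow> A s t = 0"
  shows "mprod J0 A B = mprod J A B"
  unfolding mprod_def using assms by (intro ext sum.mono_neutral_left) auto

lemma mprod_support_rows:
  assumes "finite J" "J0 \<subseteq> J" "\<And>s t. s \<notin> J0 \<Longrightarrow> B s t = 0"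
  shows "mprod J0 A B = mprod J A B"
  unfolding mprod_def using assms by (intro ext sum.mono_neutral_left) auto

text \<open>The values off \<open>J \<times> J\<close> are pinned to zero: this makes the inverse unique, and it makes the
  inverse on a subset of \<open>J\<close> the zero-padded one that can be compared with the inverse on \<open>J\<close>.\<close>

definition inverse_on :: "'t set \<Rightarrow> ('t \<Rightarrow> 't \<Rightarrow> real) \<Rightarrow> ('t \<Rightarrow> 't \<Rightarrow> real) \<Rightarrow> bool" where
  "inverse_on J C P \<longleftrightarrow> (\<forall>s t. s \<notin> J \<or> t \<notin> J \<longrightarrow> P s t = 0) \<and>
     (\<forall>s\<in>J. \<forall>t\<in>J. mprod J P C s t = (if s = t then 1 else 0) \<and> mprod J C P s t = (if s = t then 1 else 0))"

definition nondegenerate_on :: "'t set \<Rightarrow> ('t \<Rightarrow> 't \<Rightarrow> real) \<Rightarrow> bool" where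
  "nondegenerate_on J C \<longleftrightarrow>
     (\<forall>x. (\<forall>s\<in>J. (\<Sum>t\<in>J. C s t * x t) = 0) \<longrightarrow> (\<forall>t\<in>J. x t = 0))"

text \<open>The transpose is a left inverse of the symmetric \<open>C\<close>, and a left inverse equals a right
  inverse.\<close>

lemma inverse_on_sym:
  assumes "finite J" and C: "\<And>s t. C s t = C t s" and P: "inverse_on J C P"
  shows "P s t = P t s"
proof -
  have P0: "\<And>s t. s \<notin> J \<or> t \<notin> J \<Longrightarrow> P s t = 0" using P by (auto simp: inverse_on_def)
  define T where "T = (\<lambda>s t. P t s)"
  have TC: "mprod J T C s t = mprod J C P t s" for s t
    unfolding mprod_def T_def by (simp add: C mult.commute)
  have "mprod J (mprod J T C) P = P"
    using P P0 TC by (intro mprod_unit_left assms) (auto simp: inverse_on_def mprod_def T_def)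
  moreover have "mprod J T (mprod J C P) = T"
    using P P0 by (intro mprod_unit_right assms) (auto simp: inverse_on_def mprod_def T_def)
  ultimately have "T = P" by (simp add: mprod_assoc)
  then show ?thesis unfolding T_def by metis
qed

text \<open>As \<open>R\<close> vanishes off \<open>J0 \<times> J0\<close>, every sum over \<open>J0\<close> in which it occurs is a sum over \<open>J\<close>, and the
  two pieces of information can be compared on the same index set.\<close>

lemma (in gram) information_monotone_subset:
  assumes J0: "J0 \<subseteq> J" and C_sym: "\<And>s t. C s t = C t s" and S_sym: "\<And>s t. S s t = S t s"
    and P: "inverse_on J C P" and R: "inverse_on J0 C R"
  shows "bform J0 R x x + 1 / 2 * mtrace J0 (mprod J0 (mprod J0 (mprod J0 R S) R) S)
     \<le> bform J P x x + 1 / 2 * mtrace J (mprod J (mprod J (mprod J P S) P) S)"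
proof -
  have fin0: "finite J0" using J0 fin by (rule finite_subset)
  have P0: "\<And>s t. s \<notin> J \<or> t \<notin> J \<Longrightarrow> P s t = 0" and R0: "\<And>s t. s \<notin> J0 \<or> t \<notin> J0 \<Longrightarrow> R s t = 0"
    using P R by (auto simp: inverse_on_def)
  have R0': "\<And>s t. s \<notin> J \<or> t \<notin> J \<Longrightarrow> R s t = 0" using R0 J0 by blast
  have PC: "\<And>A. (\<And>s t. s \<notin> J \<Longrightarrow> A s t = 0) \<Longrightarrow> mprod J (mprod J P C) A = A"
    using P P0 by (intro mprod_unit_left fin) (auto simp: inverse_on_def mprod_def)
  have CP: "\<And>A. (\<And>s t. t \<notin> J \<Longrightarrow> A s t = 0) \<Longrightarrow> mprod J A (mprod J C P) = A"
    using P P0 by (intro mprod_unit_right fin) (auto simp: inverse_on_def mprod_def)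
  have sup: "mprod J0 R B = mprod J R B" for B
    using R0 by (intro mprod_support fin J0) auto
  have RC: "mprod J (mprod J R C) R = R"
  proof -
    have "mprod J (mprod J R C) R = mprod J0 (mprod J0 R C) R"
    proof (intro ext)
      fix s u
      show "mprod J (mprod J R C) R s u = mprod J0 (mprod J0 R C) R s u"
        unfolding sup unfolding mprod_def[of _ "mprod J R C"]
        using R0 J0 fin by (intro sum.mono_neutral_right) auto
    qed
    also have "\<dots> = R"
      using R R0 by (intro mprod_unit_left fin0) (auto simp: inverse_on_def mprod_def)
    finally show ?thesis .
  qed
  have P': "reflexive_inverse J C P"
    unfolding reflexive_inverse_def using inverse_on_sym[OF fin C_sym P] PC P0 by blast
  have R': "reflexive_inverse J C R"
    unfolding reflexive_inverse_def using inverse_on_sym[OF fin0 C_sym R] RC by blast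
  have "bform J0 R x x = bform J R x x"
  proof -
    have "(\<Sum>t\<in>J0. R s t * (x s * x t)) = (\<Sum>t\<in>J. R s t * (x s * x t))" for s
      using R0 J0 fin by (intro sum.mono_neutral_left) auto
    then show ?thesis
      unfolding bform_def using R0 J0 fin by (simp, intro sum.mono_neutral_left) auto
  qed
  moreover have "mtrace J0 (mprod J0 (mprod J0 (mprod J0 R S) R) S) = mtrace J (mprod J (mprod J (mprod J R S) R) S)"
  proof -
    have "mprod J0 (mprod J0 (mprod J0 R S) R) S = mprod J (mprod J (mprod J R S) R) S"
    proof -
      have "mprod J R S s t = 0" if "s \<notin> J0" for s t
        using R0 that by (simp add: mprod_def)
      from mprod_support_rows[OF fin J0 this] show ?thesis by (simp add: mprod_assoc sup)
    qed
    moreover have "mprod J (mprod J (mprod J R S) R) S s s = 0" if "s \<notin> J0" for s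
      unfolding mprod_assoc using R0 that by (simp add: mprod_def[of J R])
    ultimately show ?thesis
      unfolding mtrace_def using J0 fin by (simp, intro sum.mono_neutral_left) auto
  qed
  ultimately show ?thesis
    using information_monotone[OF P' R' PC _ S_sym] R0' CP[of R] by (simp add: mprod_assoc)
qed

section \<open>The information of a Gaussian vector\<close>

text \<open>The link to the matrices of size \<open>length ts\<close> in which the information is defined.\<close>

definition tab :: "'t list \<Rightarrow> ('t \<Rightarrow> 't \<Rightarrow> real) \<Rightarrow> real mat" where
  "tab ts A = Matrix.mat (length ts) (length ts) (\<lambda>(i, j). A (ts ! i) (ts ! j))"

lemma sum_nth_distinct:
  assumes "distinct ts"
  shows "(\<Sum>i\<in>{0..<length ts}. f (ts ! i)) = (\<Sum>t\<in>set ts. f t)"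
proof -
  have "bij_betw ((!) ts) {0..<length ts} (set ts)"
    by (rule bij_betw_nth[OF assms]) auto
  then show ?thesis by (rule sum.reindex_bij_betw)
qed

lemma tab_mult: "distinct ts \<Longrightarrow> tab ts A * tab ts B = tab ts (mprod (set ts) A B)"
  by (rule eq_matI) (simp_all add: tab_def scalar_prod_def mprod_def flip: sum_nth_distinct)

lemma mat_trace_tab: "distinct ts \<Longrightarrow> mat_trace (tab ts A) = mtrace (set ts) A"
  by (simp add: mat_trace_def tab_def mtrace_def lessThan_atLeast0 flip: sum_nth_distinct)

lemma tab_bform:
  assumes "distinct ts"
  shows "scalar_prod (Matrix.vec (length ts) (\<lambda>i. x (ts ! i)))
      (mult_mat_vec (tab ts A) (Matrix.vec (length ts) (\<lambda>i. y (ts ! i)))) = bform (set ts) A x y"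
  using assms
  by (simp add: scalar_prod_def tab_def bform_def sum_distrib_left mult_ac flip: sum_nth_distinct)

text \<open>A square matrix with trivial kernel has nonzero determinant, so the Gauss-Jordan inverse
  exists; it is then rewritten as an array indexed by the entries of \<open>ts\<close>.\<close>

lemma tab_inverse:
  assumes ts: "distinct ts"
    and C: "nondegenerate_on (set ts) C"
  obtains P where "the (mat_inverse (tab ts C)) = tab ts P" "inverse_on (set ts) C P"
proof -
  define k where "k = length ts"
  define ix where "ix = the_inv_into {0..<k} ((!) ts)"
  have ix: "ix (ts ! i) = i" if "i < k" for i
    unfolding ix_def using that ts by (intro the_inv_into_f_f) (auto simp: k_def inj_on_def nth_eq_iff_index_eq)
  have carr: "tab ts C \<in> carrier_mat k k" by (simp add: tab_def k_def)
  have "det (tab ts C) \<noteq> 0"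
  proof
    assume "det (tab ts C) = 0"
    then obtain v where v: "v \<in> carrier_vec k" "v \<noteq> 0\<^sub>v k" "mult_mat_vec (tab ts C) v = 0\<^sub>v k"
      using det_0_iff_vec_prod_zero_field[OF carr] by auto
    have "vec_index v (ix t) = 0" if "t \<in> set ts" for t
    proof (rule C[unfolded nondegenerate_on_def, rule_format, OF _ that])
      fix s assume "s \<in> set ts"
      then obtain i where i: "i < k" "s = ts ! i" by (auto simp: in_set_conv_nth k_def)
      have "(\<Sum>t\<in>set ts. C s t * vec_index v (ix t)) = (\<Sum>j\<in>{0..<k}. C s (ts ! j) * vec_index v j)"
        using ix by (simp add: k_def flip: sum_nth_distinct[OF ts])
      also have "\<dots> = vec_index (mult_mat_vec (tab ts C) v) i"
        using i v(1) by (simp add: tab_def scalar_prod_def k_def)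
      also have "\<dots> = 0" using v(3) i by simp
      finally show "(\<Sum>t\<in>set ts. C s t * vec_index v (ix t)) = 0" .
    qed
    hence "v = 0\<^sub>v k"
      using v(1) ix by (intro eq_vecI) (auto simp: k_def, metis nth_mem)
    with v(2) show False by simp
  qed
  note unit = det_non_zero_imp_unit[OF carr this]
  have "mat_inverse (tab ts C) \<noteq> None"
  proof
    assume "mat_inverse (tab ts C) = None"
    from mat_inverse(1)[OF carr this] unit show False by (rule notE)
  qed
  then obtain B where B: "mat_inverse (tab ts C) = Some B" by blast
  from mat_inverse(2)[OF carr B]
  have inv: "tab ts C * B = 1\<^sub>m k" "B * tab ts C = 1\<^sub>m k" "B \<in> carrier_mat k k" by auto
  define P where "P s t = (if s \<in> set ts \<and> t \<in> set ts then B $$ (ix s, ix t) else 0)" for s t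
  have BP: "B = tab ts P"
    using inv(3) ix by (intro eq_matI) (auto simp: tab_def P_def k_def)
  have unit_nth: "A s t = (if s = t then 1 else 0)" if A: "tab ts A = 1\<^sub>m k" and st: "s \<in> set ts" "t \<in> set ts" for A s t
  proof -
    obtain i j where ij: "i < k" "j < k" "s = ts ! i" "t = ts ! j"
      using st unfolding in_set_conv_nth k_def by blast
    have "A s t = tab ts A $$ (i, j)" using ij by (simp add: tab_def k_def)
    also have "\<dots> = (if i = j then 1 else 0)" unfolding A using ij by simp
    also have "\<dots> = (if s = t then 1 else 0)"
      using ij ts by (simp add: nth_eq_iff_index_eq k_def)
    finally show ?thesis .
  qed
  have "inverse_on (set ts) C P"
    unfolding inverse_on_def
    using unit_nth[of "mprod (set ts) P C"] unit_nth[of "mprod (set ts) C P"] inv(1,2)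
    by (auto simp: BP tab_mult[OF ts] P_def)
  with that[of P] B BP show thesis by simp
qed

lemma sum_mprod_left: "mprod J (\<lambda>s t. \<Sum>\<alpha>\<in>I. c \<alpha> * A \<alpha> s t) B = (\<lambda>s t. \<Sum>\<alpha>\<in>I. c \<alpha> * mprod J (A \<alpha>) B s t)"
  unfolding mprod_def by (intro ext) (simp add: sum_distrib_right sum_distrib_left mult.assoc, rule sum.swap)

lemma sum_mprod_right: "mprod J B (\<lambda>s t. \<Sum>\<alpha>\<in>I. c \<alpha> * A \<alpha> s t) = (\<lambda>s t. \<Sum>\<alpha>\<in>I. c \<alpha> * mprod J B (A \<alpha>) s t)"
  unfolding mprod_def by (intro ext) (simp add: sum_distrib_left mult.left_commute, rule sum.swap)

lemma sum_mtrace: "mtrace J (\<lambda>s t. \<Sum>\<alpha>\<in>I. c \<alpha> * A \<alpha> s t) = (\<Sum>\<alpha>\<in>I. c \<alpha> * mtrace J (A \<alpha>))"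
  unfolding mtrace_def by (simp add: sum_distrib_left, rule sum.swap)

lemma sum_bform_left: "bform J A (\<lambda>s. \<Sum>\<alpha>\<in>I. c \<alpha> * d \<alpha> s) y = (\<Sum>\<alpha>\<in>I. c \<alpha> * bform J A (d \<alpha>) y)"
proof -
  have "bform J A (\<lambda>s. \<Sum>\<alpha>\<in>I. c \<alpha> * d \<alpha> s) y = (\<Sum>s\<in>J. \<Sum>t\<in>J. \<Sum>\<alpha>\<in>I. c \<alpha> * (A s t * (d \<alpha> s * y t)))"
    by (simp add: bform_def sum_distrib_right sum_distrib_left mult_ac)
  also have "\<dots> = (\<Sum>s\<in>J. \<Sum>\<alpha>\<in>I. \<Sum>t\<in>J. c \<alpha> * (A s t * (d \<alpha> s * y t)))"
    by (rule sum.cong[OF refl], rule sum.swap)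
  also have "\<dots> = (\<Sum>\<alpha>\<in>I. c \<alpha> * bform J A (d \<alpha>) y)"
    by (rule trans[OF sum.swap]) (simp add: bform_def sum_distrib_left)
  finally show ?thesis .
qed

lemma bform_commute: "(\<And>s t. A s t = A t s) \<Longrightarrow> bform J A x y = bform J A y x"
  unfolding bform_def by (rule trans[OF sum.swap]) (simp add: mult.commute)

definition mean_deriv where
  "mean_deriv M X \<theta> \<gamma> t = partial_deriv \<gamma> (\<lambda>\<eta>. mean_fun M (X \<eta>) t) \<theta>"

definition cov_deriv where
  "cov_deriv M X \<theta> \<gamma> s t = partial_deriv \<gamma> (\<lambda>\<eta>. cov_fun M (X \<eta>) s t) \<theta>"

lemma cov_fun_commute: "cov_fun M X s t = cov_fun M X t s"
  by (simp add: cov_fun_def mult.commute)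

lemma gaussian_information_nth:
  assumes ts: "distinct ts" and P: "the (mat_inverse (tab ts (cov_fun M (X \<theta>)))) = tab ts P"
  shows "gaussian_information M X ts \<theta> $ \<alpha> $ \<beta>
     = bform (set ts) P (mean_deriv M X \<theta> \<alpha>) (mean_deriv M X \<theta> \<beta>)
       + 1 / 2 * mtrace (set ts) (mprod (set ts) (mprod (set ts) (mprod (set ts) P (cov_deriv M X \<theta> \<alpha>)) P) (cov_deriv M X \<theta> \<beta>))"
proof -
  have "Matrix.mat (length ts) (length ts) (\<lambda>(i, j). partial_deriv \<gamma> (\<lambda>\<eta>. cov_fun M (X \<eta>) (ts ! i) (ts ! j)) \<theta>)
      = tab ts (cov_deriv M X \<theta> \<gamma>)" for \<gamma>
    by (simp add: tab_def cov_deriv_def)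
  moreover have "Matrix.mat (length ts) (length ts) (\<lambda>(i, j). cov_fun M (X \<theta>) (ts ! i) (ts ! j))
      = tab ts (cov_fun M (X \<theta>))"
    by (simp add: tab_def)
  moreover have "Matrix.vec (length ts) (\<lambda>i. partial_deriv \<gamma> (\<lambda>\<eta>. mean_fun M (X \<eta>) (ts ! i)) \<theta>)
      = Matrix.vec (length ts) (\<lambda>i. mean_deriv M X \<theta> \<gamma> (ts ! i))" for \<gamma>
    by (simp add: mean_deriv_def)
  ultimately show ?thesis
    by (simp only: gaussian_information_def Let_def vec_lambda_beta P tab_bform[OF ts] tab_mult[OF ts] mat_trace_tab[OF ts])
qed

text \<open>Both parts of the information are bilinear in the derivatives, so the quadratic form in the
  direction \<open>v\<close> is the information expression for the derivatives in this direction.\<close>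

lemma gaussian_information_form:
  assumes ts: "distinct ts" and P: "the (mat_inverse (tab ts (cov_fun M (X \<theta>)))) = tab ts P"
  defines "J \<equiv> set ts"
  shows "inner v (gaussian_information M X ts \<theta> *v v)
     = bform J P (\<lambda>t. \<Sum>\<alpha>\<in>UNIV. v $ \<alpha> * mean_deriv M X \<theta> \<alpha> t) (\<lambda>t. \<Sum>\<alpha>\<in>UNIV. v $ \<alpha> * mean_deriv M X \<theta> \<alpha> t)
       + 1 / 2 * mtrace J (mprod J (mprod J (mprod J P
           (\<lambda>s t. \<Sum>\<alpha>\<in>UNIV. v $ \<alpha> * cov_deriv M X \<theta> \<alpha> s t)) P) (\<lambda>s t. \<Sum>\<alpha>\<in>UNIV. v $ \<alpha> * cov_deriv M X \<theta> \<alpha> s t))"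
proof -
  have right: "bform J P x (\<lambda>t. \<Sum>\<alpha>\<in>UNIV. v $ \<alpha> * mean_deriv M X \<theta> \<alpha> t) = (\<Sum>\<alpha>\<in>UNIV. v $ \<alpha> * bform J P x (mean_deriv M X \<theta> \<alpha>))" for x
  proof -
    have fl: "bform J A x y = bform J (\<lambda>s t. A t s) y x" for A x y
      unfolding bform_def by (rule trans[OF sum.swap]) (simp add: mult.commute)
    show ?thesis by (subst (1 2) fl) (rule sum_bform_left)
  qed
  have "inner v (gaussian_information M X ts \<theta> *v v)
    = (\<Sum>\<alpha>\<in>UNIV. v $ \<alpha> * (\<Sum>\<beta>\<in>UNIV. v $ \<beta> * gaussian_information M X ts \<theta> $ \<alpha> $ \<beta>))"
    by (simp add: inner_vec_def matrix_vector_mult_def mult.commute)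
  moreover have "bform J P (\<lambda>t. \<Sum>\<alpha>\<in>UNIV. v $ \<alpha> * mean_deriv M X \<theta> \<alpha> t) (\<lambda>t. \<Sum>\<alpha>\<in>UNIV. v $ \<alpha> * mean_deriv M X \<theta> \<alpha> t)
    = (\<Sum>\<alpha>\<in>UNIV. v $ \<alpha> * (\<Sum>\<beta>\<in>UNIV. v $ \<beta> * bform J P (mean_deriv M X \<theta> \<alpha>) (mean_deriv M X \<theta> \<beta>)))"
    by (simp only: sum_bform_left right)
  moreover have "mtrace J (mprod J (mprod J (mprod J P
           (\<lambda>s t. \<Sum>\<alpha>\<in>UNIV. v $ \<alpha> * cov_deriv M X \<theta> \<alpha> s t)) P) (\<lambda>s t. \<Sum>\<alpha>\<in>UNIV. v $ \<alpha> * cov_deriv M X \<theta> \<alpha> s t))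
    = (\<Sum>\<alpha>\<in>UNIV. v $ \<alpha> * (\<Sum>\<beta>\<in>UNIV. v $ \<beta> * mtrace J (mprod J (mprod J (mprod J P (cov_deriv M X \<theta> \<alpha>)) P) (cov_deriv M X \<theta> \<beta>))))"
    by (simp only: sum_mprod_left sum_mprod_right sum_mtrace)
  ultimately show ?thesis
    unfolding gaussian_information_nth[where X = X and \<theta> = \<theta>, OF ts P] J_def[symmetric]
    by (simp add: distrib_left sum.distrib sum_distrib_left mult_ac)
qed

lemma gaussian_information_sym:
  assumes ts: "distinct ts" and P: "the (mat_inverse (tab ts (cov_fun M (X \<theta>)))) = tab ts P"
    and sym: "\<And>s t. P s t = P t s"
  shows "gaussian_information M X ts \<theta> $ \<alpha> $ \<beta> = gaussian_information M X ts \<theta> $ \<beta> $ \<alpha>"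
proof -
  have "mtrace J (mprod J (mprod J (mprod J P A) P) B) = mtrace J (mprod J (mprod J (mprod J P B) P) A)"
    for J A B using mtrace_commute[of J "mprod J P A" "mprod J P B"] by (simp add: mprod_assoc)
  then show ?thesis
    unfolding gaussian_information_nth[where X = X and \<theta> = \<theta>, OF ts P]
    by (intro arg_cong2[where f = "(+)"] arg_cong2[where f = "(*)"] refl bform_commute sym)
qed

text \<open>Apart from \<open>information_monotone_subset\<close> this uses that the covariance derivatives are symmetric:
  \<open>cov_fun M (X \<eta>)\<close> is symmetric for each \<open>\<eta>\<close>, so the derivatives of two transposed entries are
  derivatives of the same function.\<close>

lemma gaussian_information_monotone:
  fixes X :: "real ^ 'i::finite \<Rightarrow> real \<Rightarrow> 'w \<Rightarrow> real"
  assumes gram: "gram M (\<lambda>t \<omega>. X \<theta> t \<omega> - mean_fun M (X \<theta>) t) (set ts) (cov_fun M (X \<theta>))"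
    and ts: "distinct ts" "distinct ts0" "set ts0 \<subseteq> set ts"
    and nondeg: "nondegenerate_on (set ts) (cov_fun M (X \<theta>))" "nondegenerate_on (set ts0) (cov_fun M (X \<theta>))"
  shows "loewner_ge (gaussian_information M X ts \<theta>) (gaussian_information M X ts0 \<theta>)"
proof -
  interpret gram M "\<lambda>t \<omega>. X \<theta> t \<omega> - mean_fun M (X \<theta>) t" "set ts" "cov_fun M (X \<theta>)" by (rule gram)
  obtain P where P: "the (mat_inverse (tab ts (cov_fun M (X \<theta>)))) = tab ts P" "inverse_on (set ts) (cov_fun M (X \<theta>)) P"
    using tab_inverse[OF ts(1) nondeg(1)] by blast
  obtain R where R: "the (mat_inverse (tab ts0 (cov_fun M (X \<theta>)))) = tab ts0 R" "inverse_on (set ts0) (cov_fun M (X \<theta>)) R"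
    using tab_inverse[OF ts(2) nondeg(2)] by blast
  let ?A = "gaussian_information M X ts \<theta>" and ?B = "gaussian_information M X ts0 \<theta>"
  have symA: "?A $ \<alpha> $ \<beta> = ?A $ \<beta> $ \<alpha>" for \<alpha> \<beta>
    by (rule gaussian_information_sym[where X = X and \<theta> = \<theta>, OF ts(1) P(1) inverse_on_sym[OF finite_set cov_fun_commute P(2)]])
  have symB: "?B $ \<alpha> $ \<beta> = ?B $ \<beta> $ \<alpha>" for \<alpha> \<beta>
    by (rule gaussian_information_sym[where X = X and \<theta> = \<theta>, OF ts(2) R(1) inverse_on_sym[OF finite_set cov_fun_commute R(2)]])
  have "Finite_Cartesian_Product.transpose (?A - ?B) = ?A - ?B"
    unfolding Finite_Cartesian_Product.vec_eq_iff
  proof (intro allI)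
    fix \<alpha> \<beta>
    show "Finite_Cartesian_Product.transpose (?A - ?B) $ \<alpha> $ \<beta> = (?A - ?B) $ \<alpha> $ \<beta>"
      using symA[of \<alpha> \<beta>] symB[of \<alpha> \<beta>] by (simp add: Finite_Cartesian_Product.transpose_def)
  qed
  moreover have "0 \<le> inner v ((?A - ?B) *v v)" for v
  proof -
    have sym: "cov_deriv M X \<theta> \<alpha> s t = cov_deriv M X \<theta> \<alpha> t s" for \<alpha> s t
      unfolding cov_deriv_def by (subst cov_fun_commute) (rule refl)
    have "inner v (?B *v v) \<le> inner v (?A *v v)"
      unfolding gaussian_information_form[where X = X and \<theta> = \<theta>, OF ts(1) P(1)]
        gaussian_information_form[where X = X and \<theta> = \<theta>, OF ts(2) R(1)]
      by (rule information_monotone_subset[OF ts(3) cov_fun_commute _ P(2) R(2)])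
         (intro sum.cong refl arg_cong2[where f = "(*)"] sym)
    then show ?thesis by (simp add: matrix_vector_mult_diff_rdistrib inner_diff_right)
  qed
  ultimately show ?thesis by (simp add: loewner_ge_def)
qed

section \<open>Square integrable functions\<close>

definition square_integrable :: "'a measure \<Rightarrow> ('a \<Rightarrow> real) \<Rightarrow> bool" where
  "square_integrable M f \<longleftrightarrow> f \<in> borel_measurable M \<and> integrable M (\<lambda>x. (f x)\<^sup>2)"

lemma square_integrable_measurable: "square_integrable M f \<Longrightarrow> f \<in> borel_measurable M"
  by (simp add: square_integrable_def)

lemma square_integrable_mult:
  assumes "square_integrable M f" "square_integrable M g"
  shows "integrable M (\<lambda>x. f x * g x)"
proof (rule Bochner_Integration.integrable_bound)
  show "integrable M (\<lambda>x. (f x)\<^sup>2 + (g x)\<^sup>2)"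
    using assms by (simp add: square_integrable_def)
  show "AE x in M. norm (f x * g x) \<le> norm ((f x)\<^sup>2 + (g x)\<^sup>2)"
  proof (intro AE_I2)
    fix x
    have "2 * \<bar>f x * g x\<bar> \<le> (f x)\<^sup>2 + (g x)\<^sup>2"
      using sum_squares_bound[of "\<bar>f x\<bar>" "\<bar>g x\<bar>"] by (simp add: abs_mult)
    then show "norm (f x * g x) \<le> norm ((f x)\<^sup>2 + (g x)\<^sup>2)" by simp
  qed
qed (use assms in \<open>auto simp: square_integrable_def\<close>)

lemma square_integrable_cmult: "square_integrable M f \<Longrightarrow> square_integrable M (\<lambda>x. c * f x)"
  by (auto simp: square_integrable_def power_mult_distrib)

lemma square_integrable_add:
  assumes "square_integrable M f" "square_integrable M g"
  shows "square_integrable M (\<lambda>x. f x + g x)"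
proof -
  have "integrable M (\<lambda>x. (f x)\<^sup>2 + (g x)\<^sup>2 + 2 * (f x * g x))"
    using assms square_integrable_mult[OF assms] by (simp add: square_integrable_def)
  then show ?thesis
    using assms by (auto simp: square_integrable_def power2_sum mult.assoc)
qed

lemma square_integrable_diff:
  assumes "square_integrable M f" "square_integrable M g"
  shows "square_integrable M (\<lambda>x. f x - g x)"
  using square_integrable_add[OF assms(1) square_integrable_cmult[OF assms(2), of "-1"]] by simp

lemma square_integrable_sum:
  assumes "\<And>i. i \<in> I \<Longrightarrow> square_integrable M (f i)"
  shows "square_integrable M (\<lambda>x. \<Sum>i\<in>I. f i x)"
  using assms
  by (induction I rule: infinite_finite_induct)
     (auto intro: square_integrable_add simp: square_integrable_def[of M "\<lambda>x. 0"])

lemma (in finite_measure) square_integrable_const: "square_integrable M (\<lambda>x. c)"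
  by (simp add: square_integrable_def)

lemma (in finite_measure) square_integrable_integrable:
  "square_integrable M f \<Longrightarrow> integrable M f"
  using square_integrable_mult[OF _ square_integrable_const[of 1], of f] by simp

lemma square_integrable_cong_AE:
  assumes "square_integrable M f" "g \<in> borel_measurable M" "AE x in M. f x = g x"
  shows "square_integrable M g"
  using assms by (auto simp: square_integrable_def elim!: integrable_cong_AE_imp)

lemma square_integrable_abs: "square_integrable M f \<Longrightarrow> square_integrable M (\<lambda>x. \<bar>f x\<bar>)"
  by (auto simp: square_integrable_def)

lemma square_integrable_bound:
  assumes "square_integrable M f" "g \<in> borel_measurable M" "\<And>x. \<bar>g x\<bar> \<le> \<bar>f x\<bar>"
  shows "square_integrable M g"
  unfolding square_integrable_def
proof (rule conjI[OF assms(2)], rule Bochner_Integration.integrable_bound)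
  show "integrable M (\<lambda>x. (f x)\<^sup>2)" "(\<lambda>x. (g x)\<^sup>2) \<in> borel_measurable M"
    using assms(1,2) by (auto simp: square_integrable_def)
  show "AE x in M. norm ((g x)\<^sup>2) \<le> norm ((f x)\<^sup>2)"
    using assms(3) by (intro AE_I2) (simp add: abs_le_square_iff)
qed

lemma square_integrableI_nn:
  assumes "f \<in> borel_measurable M" "(\<integral>\<^sup>+ x. ennreal ((f x)\<^sup>2) \<partial>M) < \<infinity>"
  shows "square_integrable M f"
  using assms by (auto simp: square_integrable_def intro!: integrableI_nonneg)

lemma nn_integral_square:
  "square_integrable M f \<Longrightarrow> (\<integral>\<^sup>+ x. ennreal ((f x)\<^sup>2) \<partial>M) = ennreal (\<integral>x. (f x)\<^sup>2 \<partial>M)"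
  by (auto simp: square_integrable_def intro!: nn_integral_eq_integral)

lemma integral_Cauchy_Schwarz:
  assumes f: "square_integrable M f" and g: "square_integrable M g"
  shows "(\<integral>x. f x * g x \<partial>M)\<^sup>2 \<le> (\<integral>x. (f x)\<^sup>2 \<partial>M) * (\<integral>x. (g x)\<^sup>2 \<partial>M)"
proof -
  have [measurable]: "f \<in> borel_measurable M" "g \<in> borel_measurable M"
    using f g by (auto simp: square_integrable_def)
  have int: "integrable M (\<lambda>x. \<bar>f x\<bar> * \<bar>g x\<bar>)"
    by (intro square_integrable_mult square_integrable_abs f g)
  have "ennreal ((\<integral>x. \<bar>f x\<bar> * \<bar>g x\<bar> \<partial>M)\<^sup>2) = (\<integral>\<^sup>+x. ennreal \<bar>f x\<bar> * ennreal \<bar>g x\<bar> \<partial>M)\<^sup>2"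
    using nn_integral_eq_integral[OF int] by (simp add: ennreal_mult ennreal_power)
  also have "\<dots> \<le> (\<integral>\<^sup>+x. (ennreal \<bar>f x\<bar>)\<^sup>2 \<partial>M) * (\<integral>\<^sup>+x. (ennreal \<bar>g x\<bar>)\<^sup>2 \<partial>M)"
    by (rule Cauchy_Schwarz_nn_integral) auto
  also have "\<dots> = ennreal ((\<integral>x. (f x)\<^sup>2 \<partial>M) * (\<integral>x. (g x)\<^sup>2 \<partial>M))"
    by (simp add: ennreal_power nn_integral_square[OF f] nn_integral_square[OF g] ennreal_mult)
  finally have "(\<integral>x. \<bar>f x\<bar> * \<bar>g x\<bar> \<partial>M)\<^sup>2 \<le> (\<integral>x. (f x)\<^sup>2 \<partial>M) * (\<integral>x. (g x)\<^sup>2 \<partial>M)"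
    by (subst (asm) ennreal_le_iff) auto
  moreover have "\<bar>\<integral>x. f x * g x \<partial>M\<bar> \<le> (\<integral>x. \<bar>f x\<bar> * \<bar>g x\<bar> \<partial>M)"
    using integral_abs_bound[of M "\<lambda>x. f x * g x"] by (simp add: abs_mult)
  hence "(\<integral>x. f x * g x \<partial>M)\<^sup>2 \<le> (\<integral>x. \<bar>f x\<bar> * \<bar>g x\<bar> \<partial>M)\<^sup>2"
    by (metis abs_ge_zero power2_abs power_mono)
  ultimately show ?thesis by linarith
qed

text \<open>Inner products are continuous with respect to mean-square convergence, by the
  Cauchy-Schwarz inequality.\<close>

lemma square_integrable_limit:
  assumes Z: "Z \<in> borel_measurable M" and S: "\<And>k. square_integrable M (S k)"
    and lim: "(\<lambda>k. \<integral>\<^sup>+ x. ennreal ((Z x - S k x)\<^sup>2) \<partial>M) \<longlonglongrightarrow> 0"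
  shows "square_integrable M Z"
    and "square_integrable M N \<Longrightarrow> (\<lambda>k. \<integral>x. N x * S k x \<partial>M) \<longlonglongrightarrow> (\<integral>x. N x * Z x \<partial>M)"
    and "(\<lambda>k. \<integral>x. (Z x - S k x)\<^sup>2 \<partial>M) \<longlonglongrightarrow> 0"
proof -
  have "eventually (\<lambda>k. (\<integral>\<^sup>+ x. ennreal ((Z x - S k x)\<^sup>2) \<partial>M) < 1) sequentially"
    using lim by (rule order_tendstoD) simp
  then obtain k where "(\<integral>\<^sup>+ x. ennreal ((Z x - S k x)\<^sup>2) \<partial>M) < 1"
    by (auto simp: eventually_sequentially)
  hence "(\<integral>\<^sup>+ x. ennreal ((Z x - S k x)\<^sup>2) \<partial>M) < \<infinity>"
    by (rule less_trans) simp
  hence "square_integrable M (\<lambda>x. Z x - S k x)"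
    using Z S[of k] by (intro square_integrableI_nn) (auto simp: square_integrable_def)
  from square_integrable_add[OF this S[of k]] show sqZ: "square_integrable M Z" by simp
  have D: "square_integrable M (\<lambda>x. Z x - S k x)" for k
    by (intro square_integrable_diff sqZ S)
  show lim': "(\<lambda>k. \<integral>x. (Z x - S k x)\<^sup>2 \<partial>M) \<longlonglongrightarrow> 0"
    using lim unfolding nn_integral_square[OF D]
    by (subst (asm) ennreal_0[symmetric], subst (asm) tendsto_ennreal_iff) auto
  show "(\<lambda>k. \<integral>x. N x * S k x \<partial>M) \<longlonglongrightarrow> (\<integral>x. N x * Z x \<partial>M)" if N: "square_integrable M N"
  proof -
    have "(\<lambda>k. (\<integral>x. (N x)\<^sup>2 \<partial>M) * (\<integral>x. (Z x - S k x)\<^sup>2 \<partial>M)) \<longlonglongrightarrow> (\<integral>x. (N x)\<^sup>2 \<partial>M) * 0"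
      by (intro tendsto_mult lim' tendsto_const)
    hence "(\<lambda>k. (\<integral>x. N x * (Z x - S k x) \<partial>M)\<^sup>2) \<longlonglongrightarrow> 0"
      using tendsto_sandwich[of "\<lambda>_. 0" "\<lambda>k. (\<integral>x. N x * (Z x - S k x) \<partial>M)\<^sup>2" sequentially
          "\<lambda>k. (\<integral>x. (N x)\<^sup>2 \<partial>M) * (\<integral>x. (Z x - S k x)\<^sup>2 \<partial>M)" 0]
        integral_Cauchy_Schwarz[OF N D] by simp
    hence "(\<lambda>k. \<integral>x. N x * (Z x - S k x) \<partial>M) \<longlonglongrightarrow> 0"
      using tendsto_real_sqrt tendsto_rabs_zero_cancel by fastforce
    moreover have "(\<integral>x. N x * (Z x - S k x) \<partial>M) = (\<integral>x. N x * Z x \<partial>M) - (\<integral>x. N x * S k x \<partial>M)" for k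
      using square_integrable_mult[OF N sqZ] square_integrable_mult[OF N S[of k]]
      by (simp add: right_diff_distrib)
    ultimately have "(\<lambda>k. (\<integral>x. N x * Z x \<partial>M) - (\<integral>x. N x * S k x \<partial>M)) \<longlonglongrightarrow> 0" by simp
    from tendsto_diff[OF tendsto_const[of "\<integral>x. N x * Z x \<partial>M"] this] show ?thesis by simp
  qed
qed

section \<open>A Gronwall inequality with integrable coefficient\<close>

lemma continuous_on_indefinite_integral:
  fixes \<beta> :: "real \<Rightarrow> real"
  assumes "set_integrable lborel {0..T} \<beta>"
  shows "continuous_on {0..T} (\<lambda>t. LINT s:{0..t}|lborel. \<beta> s)"
proof -
  have "continuous_on {0..T} (\<lambda>t. integral {0..t} \<beta>)"
    using assms by (intro indefinite_integral_continuous_1 set_borel_integral_eq_integral)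
  then show ?thesis
    by (rule continuous_on_eq)
       (auto intro!: set_borel_integral_eq_integral(2)[symmetric] set_integrable_subset[OF assms])
qed

lemma set_integral_point:
  fixes \<phi> :: "real \<Rightarrow> real"
  shows "(LINT r:{c..c}|lborel. \<phi> r) = 0"
  unfolding set_lebesgue_integral_def
  by (rule integral_eq_zero_AE) (use AE_lborel_singleton[of c] in eventually_elim, auto)

lemma set_integral_split:
  fixes \<phi> :: "real \<Rightarrow> real"
  assumes "set_integrable lborel {0..t} \<phi>" "0 \<le> s" "s \<le> t"
  shows "(LINT r:{0..t}|lborel. \<phi> r) = (LINT r:{0..s}|lborel. \<phi> r) + (LINT r:{s<..t}|lborel. \<phi> r)"
proof -
  have "{0..t} = {0..s} \<union> {s<..t}" using assms by auto
  then show ?thesis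
    by (simp only:) (intro set_integral_Un set_integrable_subset[OF assms(1)], use assms in auto)
qed

text \<open>If \<open>\<integral>\<^sub>s\<^sup>t \<beta> \<le> 1 / 2\<close>, then the integral inequality bounds \<open>A = \<integral>\<^sub>0\<^sup>t \<beta> x\<close> by
  \<open>\<integral>\<^sub>0\<^sup>s \<beta> x + \<integral>\<^sub>0\<^sup>t \<beta> f + A / 2\<close>, and the last term is absorbed on the left. Finitely many steps
  of this kind reach \<open>T\<close>, which also suits a coefficient \<open>\<beta>\<close> that is merely integrable.\<close>

lemma gronwall_integral:
  fixes \<beta> :: "real \<Rightarrow> real"
  assumes \<beta>: "set_integrable lborel {0..T} \<beta>" "\<And>s. 0 \<le> \<beta> s"
  shows "\<exists>K\<ge>0. \<forall>x f. set_integrable lborel {0..T} (\<lambda>s. \<beta> s * x s) \<longrightarrow>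
    set_integrable lborel {0..T} (\<lambda>s. \<beta> s * f s) \<longrightarrow>
    (\<forall>s\<in>{0..T}. 0 \<le> x s) \<longrightarrow> (\<forall>s\<in>{0..T}. 0 \<le> f s) \<longrightarrow>
    (\<forall>s\<in>{0..T}. x s \<le> f s + (LINT r:{0..s}|lborel. \<beta> r * x r)) \<longrightarrow>
    (LINT s:{0..T}|lborel. \<beta> s * x s) \<le> K * (LINT s:{0..T}|lborel. \<beta> s * f s)"
proof -
  define G where "G t = (LINT s:{0..t}|lborel. \<beta> s)" for t
  define hyp where "hyp t x f \<longleftrightarrow> set_integrable lborel {0..t} (\<lambda>s. \<beta> s * x s) \<and>
       set_integrable lborel {0..t} (\<lambda>s. \<beta> s * f s) \<and> (\<forall>s\<in>{0..t}. 0 \<le> x s) \<and> (\<forall>s\<in>{0..t}. 0 \<le> f s) \<and>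
       (\<forall>s\<in>{0..t}. x s \<le> f s + (LINT r:{0..s}|lborel. \<beta> r * x r))" for t and x f :: "real \<Rightarrow> real"
  have hyp_mono: "hyp s x f" if "hyp t x f" "s \<le> t" for s t x f
  proof -
    have "set_integrable lborel {0..s} \<phi>" if "set_integrable lborel {0..t} \<phi>" for \<phi> :: "real \<Rightarrow> real"
      by (rule set_integrable_subset[OF that]) (use \<open>s \<le> t\<close> in auto)
    then show ?thesis using that unfolding hyp_def by simp
  qed
  have nn: "0 \<le> (LINT r:S|lborel. \<beta> r * y r)" if "\<forall>s\<in>{0..t}. 0 \<le> y s" "S \<subseteq> {0..t}" for t S and y :: "real \<Rightarrow> real"
    unfolding set_lebesgue_integral_def using that \<beta>(2)
    by (intro Bochner_Integration.integral_nonneg) (auto simp: indicator_def)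
  have step: "(LINT r:{0..t}|lborel. \<beta> r * x r) \<le> (LINT r:{0..s}|lborel. \<beta> r * x r)
      + (LINT r:{0..t}|lborel. \<beta> r * f r) + (G t - G s) * (LINT r:{0..t}|lborel. \<beta> r * x r)"
    if h: "hyp t x f" and st: "0 \<le> s" "s \<le> t" "t \<le> T" for s t x f
  proof -
    let ?A = "LINT r:{0..t}|lborel. \<beta> r * x r"
    have bt: "set_integrable lborel {0..t} \<beta>" by (rule set_integrable_subset[OF \<beta>(1)]) (use st in auto)
    have sub: "set_integrable lborel {s<..t} \<phi>" if "set_integrable lborel {0..t} \<phi>" for \<phi> :: "real \<Rightarrow> real"
      by (rule set_integrable_subset[OF that]) (use st in auto)
    have ix: "set_integrable lborel {0..t} (\<lambda>s. \<beta> s * x s)" and ifi: "set_integrable lborel {0..t} (\<lambda>s. \<beta> s * f s)"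
      using h by (auto simp: hyp_def)
    have "\<beta> r * x r \<le> \<beta> r * f r + ?A * \<beta> r" if "r \<in> {s<..t}" for r
    proof -
      have r: "r \<in> {0..t}" using that st by auto
      have "x r \<le> f r + (LINT q:{0..r}|lborel. \<beta> q * x q)" using h r by (auto simp: hyp_def)
      also have "(LINT q:{0..r}|lborel. \<beta> q * x q) \<le> ?A"
        using set_integral_split[OF ix, of r] nn[of t x "{r<..t}"] h r
        by (auto simp: hyp_def subset_iff)
      finally have "x r \<le> f r + ?A" by simp
      from mult_left_mono[OF this \<beta>(2)[of r]] show ?thesis by (simp add: algebra_simps)
    qed
    hence "(LINT r:{s<..t}|lborel. \<beta> r * x r) \<le> (LINT r:{s<..t}|lborel. \<beta> r * f r + ?A * \<beta> r)"
      by (intro set_integral_mono sub ix set_integral_add(1) set_integrable_mult_right ifi bt)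
    also have "\<dots> = (LINT r:{s<..t}|lborel. \<beta> r * f r) + ?A * (LINT r:{s<..t}|lborel. \<beta> r)"
      by (subst set_integral_add(2)) (auto intro!: sub ifi bt set_integrable_mult_right)
    also have "(LINT r:{s<..t}|lborel. \<beta> r) = G t - G s"
      using set_integral_split[OF bt, of s] st by (simp add: G_def)
    also have "(LINT r:{s<..t}|lborel. \<beta> r * f r) \<le> (LINT r:{0..t}|lborel. \<beta> r * f r)"
      using set_integral_split[OF ifi, of s] nn[of t f "{0..s}"] h st by (auto simp: hyp_def)
    finally show ?thesis
      using set_integral_split[OF ix, of s] st by (simp add: mult.commute)
  qed
  have cont: "continuous_on {0..T} G"
    unfolding G_def by (rule continuous_on_indefinite_integral[OF \<beta>(1)])
  have G0: "G 0 = 0"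
    unfolding G_def by (rule set_integral_point)
  have main: "\<exists>K\<ge>0. \<forall>x f. hyp t x f \<longrightarrow>
      (LINT s:{0..t}|lborel. \<beta> s * x s) \<le> K * (LINT s:{0..t}|lborel. \<beta> s * f s)"
    if "0 \<le> t" "t \<le> T" "G t \<le> real n / 2" for n t
    using that
  proof (induction n arbitrary: t)
    case 0
    show ?case
    proof (intro exI[of _ 1] conjI allI impI)
      fix x f assume h: "hyp t x f"
      have "(LINT r:{0..0}|lborel. \<beta> r * x r) = 0"
        by (rule set_integral_point)
      moreover have "G t * (LINT r:{0..t}|lborel. \<beta> r * x r) \<le> 0"
        using 0 nn[of t x "{0..t}"] h by (auto simp: mult_le_0_iff hyp_def)
      ultimately show "(LINT s:{0..t}|lborel. \<beta> s * x s) \<le> 1 * (LINT s:{0..t}|lborel. \<beta> s * f s)"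
        using step[OF h, of 0] 0 by (simp add: G0)
    qed simp
  next
    case (Suc n)
    obtain s where s: "0 \<le> s" "s \<le> t" "G s \<le> real n / 2" "G t - G s \<le> 1 / 2"
    proof (cases "G t \<le> real n / 2")
      case True then show ?thesis using that[of t] Suc.prems by simp
    next
      case False
      have "\<exists>s\<ge>0. s \<le> t \<and> G s = real n / 2"
        by (rule IVT') (use False Suc.prems G0 continuous_on_subset[OF cont, of "{0..t}"] in auto)
      then obtain s where "0 \<le> s" "s \<le> t" "G s = real n / 2" by blast
      then show ?thesis using that[of s] Suc.prems by (simp add: field_simps)
    qed
    obtain K where K: "0 \<le> K" "\<And>x f. hyp s x f \<Longrightarrow>
        (LINT r:{0..s}|lborel. \<beta> r * x r) \<le> K * (LINT r:{0..s}|lborel. \<beta> r * f r)"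
      using Suc.IH[of s] s Suc.prems by auto
    show ?case
    proof (intro exI[of _ "2 * K + 2"] conjI allI impI)
      fix x f assume h: "hyp t x f"
      let ?A = "LINT r:{0..t}|lborel. \<beta> r * x r" and ?F = "\<lambda>t. LINT r:{0..t}|lborel. \<beta> r * f r"
      have A: "0 \<le> ?A" using nn[of t x "{0..t}"] h by (auto simp: hyp_def)
      have F: "?F s \<le> ?F t"
        using set_integral_split[of t "\<lambda>r. \<beta> r * f r" s] nn[of t f "{s<..t}"] h s
          by (auto simp: hyp_def subset_iff)
      have "?A \<le> (LINT r:{0..s}|lborel. \<beta> r * x r) + ?F t + (G t - G s) * ?A"
        using step[OF h] s Suc.prems by simp
      also have "\<dots> \<le> K * ?F t + ?F t + 1 / 2 * ?A"
      proof (intro add_mono mult_right_mono order_refl s A)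
        have "(LINT r:{0..s}|lborel. \<beta> r * x r) \<le> K * ?F s" by (rule K(2)[OF hyp_mono[OF h s(2)]])
        also have "\<dots> \<le> K * ?F t" by (rule mult_left_mono[OF F K(1)])
        finally show "(LINT r:{0..s}|lborel. \<beta> r * x r) \<le> K * ?F t" .
      qed
      finally show "?A \<le> (2 * K + 2) * ?F t" by (simp add: algebra_simps)
    qed (use K in simp)
  qed
  show ?thesis
  proof (cases "0 \<le> T")
    case False
    then show ?thesis by (intro exI[of _ 0]) (auto simp: set_lebesgue_integral_def)
  next
    case True
    obtain n :: nat where "2 * G T \<le> real n" using real_arch_simple by blast
    with main[of T n] True obtain K where K: "0 \<le> K" "\<And>x f. hyp T x f \<Longrightarrow>
        (LINT r:{0..T}|lborel. \<beta> r * x r) \<le> K * (LINT r:{0..T}|lborel. \<beta> r * f r)"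
      by auto
    show ?thesis
      by (intro exI[of _ K] conjI K(1) allI impI, rule K(2)) (simp add: hyp_def)
  qed
qed

section \<open>Wiener integrals\<close>

lemma square_integrable_indicator_Ioc:
  "square_integrable lborel (indicator {a<..b::real} :: real \<Rightarrow> real)"
proof -
  have "(\<lambda>x. (indicator {a<..b} x :: real)\<^sup>2) = indicator {a<..b}"
    by (auto simp: indicator_def)
  moreover have "emeasure lborel {a<..b} < \<infinity>"
    by (rule emeasure_bounded_finite, rule bounded_subset[of "{a..b}"]) auto
  ultimately show ?thesis by (auto simp: square_integrable_def)
qed

lemma square_integrable_step_fun: "square_integrable lborel (step_fun n p c)"
  unfolding step_fun_def
  by (intro square_integrable_sum square_integrable_cmult square_integrable_indicator_Ioc)

lemma step_partition:
  assumes "mono_on {..n} p" "p ` {..n} \<subseteq> {0..t}" "i < n"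
  shows "0 \<le> p i" "p i \<le> p (Suc i)" "p (Suc i) \<le> t"
proof -
  have "i \<in> {..n}" "Suc i \<in> {..n}" using assms(3) by auto
  then have "p i \<in> {0..t}" "p (Suc i) \<in> {0..t}"
    using assms(2) by blast+
  then show "0 \<le> p i" "p (Suc i) \<le> t" by auto
  show "p i \<le> p (Suc i)" by (rule mono_onD[OF assms(1)]) (use assms(3) in auto)
qed

locale wiener = prob_space M for M :: "'w measure" +
  fixes W :: "real \<Rightarrow> 'w \<Rightarrow> real"
  assumes wiener: "wiener_process M W"
begin

lemma W_measurable [measurable]: "0 \<le> t \<Longrightarrow> W t \<in> borel_measurable M"
  using wiener by (simp add: wiener_process_def)

lemma W_zero: "AE \<omega> in M. W 0 \<omega> = 0"
  using wiener by (simp add: wiener_process_def)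

lemma W_increment:
  assumes "0 \<le> s" "s \<le> t"
  shows "square_integrable M (\<lambda>\<omega>. W t \<omega> - W s \<omega>)"
    and "expectation (\<lambda>\<omega>. W t \<omega> - W s \<omega>) = 0"
    and "expectation (\<lambda>\<omega>. (W t \<omega> - W s \<omega>)\<^sup>2) = t - s"
proof -
  have "square_integrable M (\<lambda>\<omega>. W t \<omega> - W s \<omega>) \<and> expectation (\<lambda>\<omega>. W t \<omega> - W s \<omega>) = 0
    \<and> expectation (\<lambda>\<omega>. (W t \<omega> - W s \<omega>)\<^sup>2) = t - s"
  proof (cases "s = t")
    case True
    then show ?thesis by (simp add: square_integrable_const)
  next
    case False
    hence st: "s < t" using assms by simp
    hence D: "distributed M lborel (\<lambda>\<omega>. W t \<omega> - W s \<omega>) (normal_density 0 (sqrt (t - s)))"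
      using wiener assms by (simp add: wiener_process_def)
    have "integrable M (\<lambda>\<omega>. (W t \<omega> - W s \<omega>)\<^sup>2)"
      using distributed_integrable[OF D, of "\<lambda>x. x\<^sup>2"] st
        integrable_normal_moment[of "sqrt (t - s)" 0 2] by simp
    moreover have "expectation (\<lambda>\<omega>. W t \<omega> - W s \<omega>) = 0"
      using normal_distributed_expectation[OF _ D] st by simp
    moreover have "expectation (\<lambda>\<omega>. (W t \<omega> - W s \<omega>)\<^sup>2) = t - s"
      using distributed_integral[OF D, of "\<lambda>x. x\<^sup>2"] st
        integral_normal_moment_even[of "sqrt (t - s)" 0 1] by (simp add: fact_numeral)
    moreover have "(\<lambda>\<omega>. W t \<omega> - W s \<omega>) \<in> borel_measurable M"
      using assms by (intro borel_measurable_diff W_measurable) auto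
    ultimately show ?thesis by (simp add: square_integrable_def)
  qed
  then show "square_integrable M (\<lambda>\<omega>. W t \<omega> - W s \<omega>)"
    and "expectation (\<lambda>\<omega>. W t \<omega> - W s \<omega>) = 0"
    and "expectation (\<lambda>\<omega>. (W t \<omega> - W s \<omega>)\<^sup>2) = t - s" by auto
qed

lemma W_square_integrable: "0 \<le> t \<Longrightarrow> square_integrable M (W t)"
  using W_zero by (intro square_integrable_cong_AE[OF W_increment(1)[of 0 t]]) auto

text \<open>By polarisation from the variances of the increments.\<close>

lemma W_second_moment:
  assumes "0 \<le> s" "0 \<le> t"
  shows "expectation (\<lambda>\<omega>. W s \<omega> * W t \<omega>) = min s t"
proof -
  have var: "expectation (\<lambda>\<omega>. (W t \<omega>)\<^sup>2) = t" if "0 \<le> t" for t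
  proof -
    have "expectation (\<lambda>\<omega>. (W t \<omega>)\<^sup>2) = expectation (\<lambda>\<omega>. (W t \<omega> - W 0 \<omega>)\<^sup>2)"
      using W_zero that by (intro integral_cong_AE) auto
    then show ?thesis using W_increment(3)[of 0 t] that by simp
  qed
  have *: "expectation (\<lambda>\<omega>. W s \<omega> * W t \<omega>) = s" if "0 \<le> s" "s \<le> t" for s t
  proof -
    have sq: "square_integrable M (W s)" "square_integrable M (W t)"
      using that by (auto intro: W_square_integrable)
    have "t - s = expectation (\<lambda>\<omega>. (W t \<omega>)\<^sup>2 + (W s \<omega>)\<^sup>2 - 2 * (W s \<omega> * W t \<omega>))"
      using W_increment(3)[of s t] that by (simp add: power2_diff mult_ac)
    also have "\<dots> = t + s - 2 * expectation (\<lambda>\<omega>. W s \<omega> * W t \<omega>)"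
      using sq square_integrable_mult[OF sq] var[of s] var[of t] that
      by (simp add: square_integrable_def)
    finally show ?thesis by simp
  qed
  show ?thesis
  proof (cases "s \<le> t")
    case True then show ?thesis using *[of s t] assms by simp
  next
    case False then show ?thesis using *[of t s] assms by (simp add: mult.commute)
  qed
qed

text \<open>The Ito isometry for two increments, from which the isometry for step functions follows by
  bilinearity.\<close>

lemma W_increments_product:
  assumes "0 \<le> a" "a \<le> b" "0 \<le> c" "c \<le> d"
  shows "expectation (\<lambda>\<omega>. (W b \<omega> - W a \<omega>) * (W d \<omega> - W c \<omega>))
      = (LINT s|lborel. indicator {a<..b} s * indicator {c<..d} s)"
proof -
  have sq: "square_integrable M (W a)" "square_integrable M (W b)"
    "square_integrable M (W c)" "square_integrable M (W d)"
    using assms by (auto intro: W_square_integrable)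
  have "expectation (\<lambda>\<omega>. (W b \<omega> - W a \<omega>) * (W d \<omega> - W c \<omega>))
    = expectation (\<lambda>\<omega>. W b \<omega> * W d \<omega> - W b \<omega> * W c \<omega> - (W a \<omega> * W d \<omega> - W a \<omega> * W c \<omega>))"
    by (simp add: algebra_simps)
  also have "\<dots> = (min b d - min b c) - (min a d - min a c)"
    using assms by (simp add: square_integrable_mult sq W_second_moment)
  also have "\<dots> = measure lborel {max a c<..min b d}"
    using assms by (cases "max a c \<le> min b d") auto
  also have "\<dots> = (LINT s|lborel. indicator {max a c<..min b d} s)" by simp
  also have "\<dots> = (LINT s|lborel. indicator {a<..b} s * indicator {c<..d} s)"
    by (intro Bochner_Integration.integral_cong) (auto simp: indicator_def)
  finally show ?thesis .
qed

lemma square_integrable_step_integral: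
  assumes "mono_on {..n} p" "p ` {..n} \<subseteq> {0..t}"
  shows "square_integrable M (step_integral W n p c)"
  unfolding step_integral_def
  by (intro square_integrable_sum square_integrable_cmult W_increment) (use step_partition[OF assms] in auto)

lemma step_integral_increment:
  assumes "mono_on {..n} p" "p ` {..n} \<subseteq> {0..t}" "0 \<le> u" "u \<le> v"
  shows "expectation (\<lambda>\<omega>. (W v \<omega> - W u \<omega>) * step_integral W n p c \<omega>)
      = (LINT s|lborel. indicator {u<..v} s * step_fun n p c s)"
proof -
  have "expectation (\<lambda>\<omega>. (W v \<omega> - W u \<omega>) * step_integral W n p c \<omega>)
    = expectation (\<lambda>\<omega>. \<Sum>i<n. c i * ((W v \<omega> - W u \<omega>) * (W (p (Suc i)) \<omega> - W (p i) \<omega>)))"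
    by (simp add: step_integral_def sum_distrib_left mult_ac)
  also have "\<dots> = (\<Sum>i<n. c i * expectation (\<lambda>\<omega>. (W v \<omega> - W u \<omega>) * (W (p (Suc i)) \<omega> - W (p i) \<omega>)))"
    using step_partition[OF assms(1,2)] assms(3,4)
    by (subst Bochner_Integration.integral_sum)
       (auto intro!: square_integrable_mult W_increment)
  also have "\<dots> = (\<Sum>i<n. c i * (LINT s|lborel. indicator {u<..v} s * indicator {p i<..p (Suc i)} s))"
    using step_partition[OF assms(1,2)] assms(3,4)
    by (intro sum.cong refl arg_cong2[where f = "(*)"] W_increments_product) auto
  also have "\<dots> = (LINT s|lborel. (\<Sum>i<n. c i * (indicator {u<..v} s * indicator {p i<..p (Suc i)} s)))"
    by (subst Bochner_Integration.integral_sum)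
       (auto intro!: square_integrable_mult square_integrable_indicator_Ioc)
  also have "\<dots> = (LINT s|lborel. indicator {u<..v} s * step_fun n p c s)"
    by (simp only: step_fun_def sum_distrib_left mult_ac)
  finally show ?thesis .
qed

lemma step_isometry:
  assumes "mono_on {..n} p" "p ` {..n} \<subseteq> {0..t}"
  shows "expectation (\<lambda>\<omega>. (step_integral W n p c \<omega>)\<^sup>2) = (LINT s|lborel. (step_fun n p c s)\<^sup>2)"
proof -
  note sq = square_integrable_step_integral[OF assms, of c]
  have "expectation (\<lambda>\<omega>. (step_integral W n p c \<omega>)\<^sup>2)
    = expectation (\<lambda>\<omega>. \<Sum>i<n. c i * ((W (p (Suc i)) \<omega> - W (p i) \<omega>) * step_integral W n p c \<omega>))"
  proof (rule Bochner_Integration.integral_cong[OF refl])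
    fix \<omega>
    have "(step_integral W n p c \<omega>)\<^sup>2 = (\<Sum>i<n. c i * (W (p (Suc i)) \<omega> - W (p i) \<omega>)) * step_integral W n p c \<omega>"
      unfolding power2_eq_square by (subst (1) step_integral_def) (rule refl)
    then show "(step_integral W n p c \<omega>)\<^sup>2 = (\<Sum>i<n. c i * ((W (p (Suc i)) \<omega> - W (p i) \<omega>) * step_integral W n p c \<omega>))"
      by (simp only: sum_distrib_right mult.assoc)
  qed
  also have "\<dots> = (\<Sum>i<n. c i * expectation (\<lambda>\<omega>. (W (p (Suc i)) \<omega> - W (p i) \<omega>) * step_integral W n p c \<omega>))"
    using step_partition[OF assms]
    by (subst Bochner_Integration.integral_sum)
       (auto intro!: square_integrable_mult W_increment sq)
  also have "\<dots> = (\<Sum>i<n. c i * (LINT s|lborel. indicator {p i<..p (Suc i)} s * step_fun n p c s))"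
    using step_partition[OF assms]
    by (intro sum.cong refl arg_cong2[where f = "(*)"] step_integral_increment[OF assms]) auto
  also have "\<dots> = (LINT s|lborel. (\<Sum>i<n. c i * (indicator {p i<..p (Suc i)} s * step_fun n p c s)))"
    by (subst Bochner_Integration.integral_sum)
       (auto intro!: square_integrable_mult square_integrable_indicator_Ioc
          square_integrable_step_fun)
  also have "\<dots> = (LINT s|lborel. (step_fun n p c s)\<^sup>2)"
  proof (rule Bochner_Integration.integral_cong[OF refl])
    fix s
    have "(step_fun n p c s)\<^sup>2 = (\<Sum>i<n. c i * indicator {p i<..p (Suc i)} s) * step_fun n p c s"
      unfolding power2_eq_square by (subst (1) step_fun_def) (rule refl)
    then show "(\<Sum>i<n. c i * (indicator {p i<..p (Suc i)} s * step_fun n p c s)) = (step_fun n p c s)\<^sup>2"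
      by (simp only: sum_distrib_right mult.assoc)
  qed
  finally show ?thesis .
qed

text \<open>The isometry passes to the mean-square limit. Null sets do not affect the
  approximation of \<open>f\<close> by step functions, so \<open>f\<close> may be exchanged for a Borel version \<open>g\<close>. For the second moment a bound that is uniform
  for \<open>t\<close> in compact intervals is enough, so the factor from \<open>(y + z)\<^sup>2 \<le> 2 y\<^sup>2 + 2 z\<^sup>2\<close> is kept.\<close>

lemma wiener_integral:
  assumes Z: "has_wiener_integral M W f t Z"
    and g: "g \<in> borel_measurable borel" and fg: "AE s in lebesgue. 0 \<le> s \<longrightarrow> f s = g s"
    and int: "set_integrable lborel {0..t} (\<lambda>s. (g s)\<^sup>2)"
  shows "square_integrable M Z"
    and "expectation (\<lambda>\<omega>. (Z \<omega>)\<^sup>2) \<le> 4 * (LINT s:{0..t}|lborel. (g s)\<^sup>2)"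
    and "0 \<le> u \<Longrightarrow> u \<le> v \<Longrightarrow> expectation (\<lambda>\<omega>. (W v \<omega> - W u \<omega>) * Z \<omega>)
       = (LINT s|lborel. indicator {u<..v} s * (indicator {0..t} s * g s))"
proof -
  from Z obtain n p c where p: "\<And>k. mono_on {..n k} (p k)" "\<And>k. p k ` {..n k} \<subseteq> {0..t}"
    and lim: "(\<lambda>k. \<integral>\<^sup>+ s. ennreal ((f s - step_fun (n k) (p k) (c k) s)\<^sup>2) \<partial>lebesgue_on {0..t}) \<longlonglongrightarrow> 0"
    and limZ: "(\<lambda>k. \<integral>\<^sup>+ \<omega>. ennreal ((Z \<omega> - step_integral W (n k) (p k) (c k) \<omega>)\<^sup>2) \<partial>M) \<longlonglongrightarrow> 0"
    and mZ: "Z \<in> borel_measurable M"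
    unfolding has_wiener_integral_def by blast
  define G where "G s = indicator {0..t} s * g s" for s
  define S where "S k = step_integral W (n k) (p k) (c k)" for k
  define F where "F k = step_fun (n k) (p k) (c k)" for k
  have mG [measurable]: "G \<in> borel_measurable borel" unfolding G_def using g by measurable
  have sqF: "square_integrable lborel (F k)" for k unfolding F_def by (rule square_integrable_step_fun)
  have mF [measurable]: "F k \<in> borel_measurable borel" for k
    using sqF[of k] by (simp add: square_integrable_def)
  have F_out: "F k s = 0" if "s \<notin> {0..t}" for k s
    unfolding F_def step_fun_def
  proof (rule sum.neutral, rule ballI)
    fix i assume "i \<in> {..<n k}"
    then show "c k i * indicator {p k i<..p k (Suc i)} s = 0"
      using step_partition[OF p(1)[of k] p(2)[of k], of i] that by (auto simp: indicator_def)
  qed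
  have "(\<integral>\<^sup>+ s. ennreal ((f s - F k s)\<^sup>2) \<partial>lebesgue_on {0..t}) = (\<integral>\<^sup>+ s. ennreal ((G s - F k s)\<^sup>2) \<partial>lborel)" for k
  proof -
    have "(\<integral>\<^sup>+ s. ennreal ((f s - F k s)\<^sup>2) \<partial>lebesgue_on {0..t})
      = (\<integral>\<^sup>+ s. ennreal ((f s - F k s)\<^sup>2) * indicator {0..t} s \<partial>lebesgue)"
      by (subst nn_integral_restrict_space) auto
    also have "\<dots> = (\<integral>\<^sup>+ s. ennreal ((G s - F k s)\<^sup>2) \<partial>lebesgue)"
      using fg by (intro nn_integral_cong_AE) (auto elim!: eventually_mono simp: G_def F_out indicator_def)
    also have "\<dots> = (\<integral>\<^sup>+ s. ennreal ((G s - F k s)\<^sup>2) \<partial>lborel)"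
      by (rule nn_integral_completion)
    finally show ?thesis .
  qed
  with lim have limG: "(\<lambda>k. \<integral>\<^sup>+ s. ennreal ((G s - F k s)\<^sup>2) \<partial>lborel) \<longlonglongrightarrow> 0"
    by (simp add: F_def)
  have sqS: "square_integrable M (S k)" for k
    unfolding S_def by (rule square_integrable_step_integral[OF p])
  note L1 = square_integrable_limit[OF mZ sqS limZ[folded S_def]]
  have mG': "G \<in> borel_measurable lborel" by simp
  note L2 = square_integrable_limit[OF mG' sqF limG]
  show "square_integrable M Z" by (rule L1(1))
  show "expectation (\<lambda>\<omega>. (W v \<omega> - W u \<omega>) * Z \<omega>)
       = (LINT s|lborel. indicator {u<..v} s * (indicator {0..t} s * g s))" if uv: "0 \<le> u" "u \<le> v"
  proof -
    have "(\<lambda>k. expectation (\<lambda>\<omega>. (W v \<omega> - W u \<omega>) * S k \<omega>)) \<longlonglongrightarrow> expectation (\<lambda>\<omega>. (W v \<omega> - W u \<omega>) * Z \<omega>)"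
      by (rule L1(2)[OF W_increment(1)[OF uv]])
    moreover have "(\<lambda>k. expectation (\<lambda>\<omega>. (W v \<omega> - W u \<omega>) * S k \<omega>)) \<longlonglongrightarrow> (LINT s|lborel. indicator {u<..v} s * G s)"
      unfolding S_def step_integral_increment[OF p uv] F_def[symmetric]
      by (rule L2(2)[OF square_integrable_indicator_Ioc])
    ultimately show ?thesis unfolding G_def by (rule LIMSEQ_unique)
  qed
  have bound: "(\<integral>x. (y x)\<^sup>2 \<partial>N) \<le> 2 * (\<integral>x. (y x - z x)\<^sup>2 \<partial>N) + 2 * (\<integral>x. (z x)\<^sup>2 \<partial>N)"
    if y: "square_integrable N y" and z: "square_integrable N z" for N :: "'c measure" and y z
  proof -
    have "(\<integral>x. (y x)\<^sup>2 \<partial>N) \<le> (\<integral>x. 2 * (y x - z x)\<^sup>2 + 2 * (z x)\<^sup>2 \<partial>N)"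
    proof (rule integral_mono)
      show "(y x)\<^sup>2 \<le> 2 * (y x - z x)\<^sup>2 + 2 * (z x)\<^sup>2" for x
        using zero_le_power2[of "y x - 2 * z x"] by (simp add: power2_eq_square algebra_simps)
    qed (use y z square_integrable_diff[OF y z] in \<open>auto simp: square_integrable_def\<close>)
    also have "\<dots> = 2 * (\<integral>x. (y x - z x)\<^sup>2 \<partial>N) + 2 * (\<integral>x. (z x)\<^sup>2 \<partial>N)"
      using z square_integrable_diff[OF y z] by (simp add: square_integrable_def)
    finally show ?thesis .
  qed
  have "expectation (\<lambda>\<omega>. (Z \<omega>)\<^sup>2)
     \<le> 2 * expectation (\<lambda>\<omega>. (Z \<omega> - S k \<omega>)\<^sup>2) + 2 * (2 * (LINT s|lborel. (G s - F k s)\<^sup>2) + 2 * (LINT s|lborel. (G s)\<^sup>2))" for k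
  proof -
    have "expectation (\<lambda>\<omega>. (Z \<omega>)\<^sup>2)
     \<le> 2 * expectation (\<lambda>\<omega>. (Z \<omega> - S k \<omega>)\<^sup>2) + 2 * expectation (\<lambda>\<omega>. (S k \<omega>)\<^sup>2)"
      by (rule bound[OF L1(1) sqS])
    also have "expectation (\<lambda>\<omega>. (S k \<omega>)\<^sup>2) = (LINT s|lborel. (F k s)\<^sup>2)"
      unfolding S_def F_def by (rule step_isometry[OF p])
    also have "(LINT s|lborel. (F k s)\<^sup>2) \<le> 2 * (LINT s|lborel. (F k s - G s)\<^sup>2) + 2 * (LINT s|lborel. (G s)\<^sup>2)"
      by (rule bound[OF sqF L2(1)])
    finally show ?thesis by (simp add: power2_commute)
  qed
  moreover have "(\<lambda>k. 2 * expectation (\<lambda>\<omega>. (Z \<omega> - S k \<omega>)\<^sup>2) + 2 * (2 * (LINT s|lborel. (G s - F k s)\<^sup>2) + 2 * (LINT s|lborel. (G s)\<^sup>2)))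
     \<longlonglongrightarrow> 2 * 0 + 2 * (2 * 0 + 2 * (LINT s|lborel. (G s)\<^sup>2))"
    by (intro tendsto_intros L1(3) L2(3))
  ultimately have "expectation (\<lambda>\<omega>. (Z \<omega>)\<^sup>2) \<le> 2 * 0 + 2 * (2 * 0 + 2 * (LINT s|lborel. (G s)\<^sup>2))"
    by (intro LIMSEQ_le_const) auto
  moreover have "(LINT s|lborel. (G s)\<^sup>2) = (LINT s:{0..t}|lborel. (g s)\<^sup>2)"
    unfolding set_lebesgue_integral_def G_def
    by (intro Bochner_Integration.integral_cong) (auto simp: indicator_def)
  ultimately show "expectation (\<lambda>\<omega>. (Z \<omega>)\<^sup>2) \<le> 4 * (LINT s:{0..t}|lborel. (g s)\<^sup>2)" by simp
qed

end

section \<open>Random Volterra equations\<close>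

text \<open>A continuous process is the limit of its values at times rounded down to the grids
  \<open>\<int> / n\<close>, and each of these approximations takes only countably many times.\<close>

lemma continuous_process_measurable:
  fixes Y :: "real \<Rightarrow> 'w \<Rightarrow> real"
  assumes meas: "\<And>s. Y s \<in> borel_measurable M"
    and cont: "\<And>\<omega>. \<omega> \<in> space M \<Longrightarrow> continuous_on UNIV (\<lambda>s. Y s \<omega>)"
  shows "(\<lambda>(\<omega>, s). Y s \<omega>) \<in> borel_measurable (M \<Otimes>\<^sub>M lborel)"
proof (rule borel_measurable_LIMSEQ_real)
  define r where "r n s = real_of_int \<lfloor>real (Suc n) * s\<rfloor> / real (Suc n)" for n :: nat and s :: real
  show "(\<lambda>n. case x of (\<omega>, s) \<Rightarrow> Y (r n s) \<omega>) \<longlonglongrightarrow> (case x of (\<omega>, s) \<Rightarrow> Y s \<omega>)"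
    if "x \<in> space (M \<Otimes>\<^sub>M lborel)" for x
  proof -
    obtain \<omega> s where x: "x = (\<omega>, s)" and \<omega>: "\<omega> \<in> space M"
      using \<open>x \<in> _\<close> by (auto simp: space_pair_measure)
    have bnd: "s - 1 / real (Suc n) \<le> r n s" "r n s \<le> s" for n
    proof -
      have "real (Suc n) * s - 1 \<le> real_of_int \<lfloor>real (Suc n) * s\<rfloor>" by linarith
      moreover have "(s - 1 / real (Suc n)) * real (Suc n) = real (Suc n) * s - 1"
        by (simp add: left_diff_distrib)
      ultimately show "s - 1 / real (Suc n) \<le> r n s"
        unfolding r_def by (subst pos_le_divide_eq) simp_all
      have "real_of_int \<lfloor>real (Suc n) * s\<rfloor> \<le> real (Suc n) * s" by linarith
      then show "r n s \<le> s" 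
        unfolding r_def by (subst pos_divide_le_eq) (simp_all add: mult.commute)
    qed
    have lim: "(\<lambda>n. s - 1 / real (Suc n)) \<longlonglongrightarrow> s - 0"
      by (intro tendsto_diff tendsto_const) (use LIMSEQ_inverse_real_of_nat in \<open>simp add: inverse_eq_divide\<close>)
    have "(\<lambda>n. r n s) \<longlonglongrightarrow> s"
      by (rule tendsto_sandwich[OF _ _ lim[unfolded diff_zero] tendsto_const])
         (intro always_eventually allI bnd)+
    hence "(\<lambda>n. Y (r n s) \<omega>) \<longlonglongrightarrow> Y s \<omega>"
      by (rule continuous_on_tendsto_compose[OF cont[OF \<omega>]]) auto
    then show ?thesis by (simp add: x)
  qed
  show "(\<lambda>x. case x of (\<omega>, s) \<Rightarrow> Y (r n s) \<omega>) \<in> borel_measurable (M \<Otimes>\<^sub>M lborel)" for n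
  proof -
    have "(\<lambda>x. (\<lambda>i x. Y (real_of_int i / real (Suc n)) (fst x)) \<lfloor>real (Suc n) * snd x\<rfloor> x)
        \<in> borel_measurable (M \<Otimes>\<^sub>M lborel)"
    proof (rule measurable_compose_countable[where
          f = "\<lambda>i x. Y (real_of_int i / real (Suc n)) (fst x)" and g = "\<lambda>x. \<lfloor>real (Suc n) * snd x\<rfloor>"])
      show "(\<lambda>x. Y (real_of_int i / real (Suc n)) (fst x)) \<in> borel_measurable (M \<Otimes>\<^sub>M lborel)" for i
        by (rule measurable_compose[OF measurable_fst meas])
      show "(\<lambda>x. \<lfloor>real (Suc n) * snd x\<rfloor>) \<in> M \<Otimes>\<^sub>M lborel \<rightarrow>\<^sub>M count_space UNIV"
        by measurable
    qed
    then show ?thesis by (simp add: r_def case_prod_beta)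
  qed
qed

lemma set_integrable_mult_continuous:
  fixes \<beta> y :: "real \<Rightarrow> real"
  assumes "set_integrable lborel {0..T} \<beta>" "continuous_on {0..T} y"
  shows "set_integrable lborel {0..T} (\<lambda>s. \<beta> s * y s)"
proof -
  have my: "(\<lambda>s. indicator {0..T} s * y s) \<in> borel_measurable lborel"
    using borel_measurable_continuous_on_indicator[OF _ assms(2)] by simp
  obtain B where "\<forall>v\<in>y ` {0..T}. \<bar>v\<bar> \<le> B"
    using compact_imp_bounded[OF compact_continuous_image[OF assms(2)]] unfolding bounded_real
    by auto
  hence B: "\<And>s. s \<in> {0..T} \<Longrightarrow> \<bar>y s\<bar> \<le> B" by simp
  have mb: "(\<lambda>s. indicator {0..T} s * \<beta> s) \<in> borel_measurable lborel"
    using assms(1) by (auto simp: set_integrable_def)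
  show ?thesis
    unfolding set_integrable_def
  proof (rule Bochner_Integration.integrable_bound)
    show "integrable lborel (\<lambda>s. B * (indicator {0..T} s *\<^sub>R \<beta> s))"
      using assms(1) by (simp add: set_integrable_def)
    have "(\<lambda>s. (indicator {0..T} s * \<beta> s) * (indicator {0..T} s * y s)) \<in> borel_measurable lborel"
      by (intro borel_measurable_times my mb)
    also have "(\<lambda>s. (indicator {0..T} s * \<beta> s) * (indicator {0..T} s * y s)) = (\<lambda>s. indicator {0..T} s *\<^sub>R (\<beta> s * y s))"
      by (auto simp: indicator_def fun_eq_iff)
    finally show "(\<lambda>s. indicator {0..T} s *\<^sub>R (\<beta> s * y s)) \<in> borel_measurable lborel" .
    show "AE s in lborel. norm (indicator {0..T} s *\<^sub>R (\<beta> s * y s)) \<le> norm (B * (indicator {0..T} s *\<^sub>R \<beta> s))"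
    proof (intro AE_I2)
      fix s
      show "norm (indicator {0..T} s *\<^sub>R (\<beta> s * y s)) \<le> norm (B * (indicator {0..T} s *\<^sub>R \<beta> s))"
      proof (cases "s \<in> {0..T}")
        case True
        have "\<bar>\<beta> s\<bar> * \<bar>y s\<bar> \<le> \<bar>\<beta> s\<bar> * \<bar>B\<bar>" using B[OF True] by (intro mult_left_mono) auto
        then show ?thesis using True by (simp add: abs_mult mult_ac)
      qed simp
    qed
  qed
qed

text \<open>The integral equation \<open>Y = f + \<integral> \<beta> Y\<close>, read path by path, with a random inhomogeneity whose
  second moments are locally bounded. The stochastic differential equation has this form with the
  Wiener integral in \<open>f\<close>.\<close>

locale volterra = prob_space M for M :: "'w measure" +
  fixes Y :: "real \<Rightarrow> 'w \<Rightarrow> real" and \<beta> :: "real \<Rightarrow> real" and f :: "real \<Rightarrow> 'w \<Rightarrow> real"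
  assumes Y_measurable: "\<And>s. Y s \<in> borel_measurable M"
    and Y_continuous: "\<And>\<omega>. continuous_on UNIV (\<lambda>s. Y s \<omega>)"
    and \<beta>_measurable [measurable]: "\<beta> \<in> borel_measurable borel"
    and \<beta>_integrable: "\<And>T. set_integrable lborel {0..T} \<beta>"
    and f_eq: "\<And>t \<omega>. f t \<omega> = Y t \<omega> - (LINT s:{0..t}|lborel. \<beta> s * Y s \<omega>)"
    and f_square: "\<And>t. 0 \<le> t \<Longrightarrow> square_integrable M (f t)"
    and f_bounded: "\<And>T. \<exists>C. \<forall>t\<in>{0..T}. expectation (\<lambda>\<omega>. (f t \<omega>)\<^sup>2) \<le> C"
begin

sublocale P: pair_sigma_finite M lborel
  by unfold_locales

lemma Y_joint [measurable]: "(\<lambda>x. Y (snd x) (fst x)) \<in> borel_measurable (M \<Otimes>\<^sub>M lborel)"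
  using continuous_process_measurable[of Y M] Y_measurable Y_continuous by (simp add: case_prod_beta)

lemma f_joint: "(\<lambda>x. f (snd x) (fst x)) \<in> borel_measurable (M \<Otimes>\<^sub>M lborel)"
proof -
  have [measurable]: "(\<lambda>p. Y (snd p) (fst (fst p))) \<in> borel_measurable ((M \<Otimes>\<^sub>M lborel) \<Otimes>\<^sub>M lborel)"
    using measurable_compose[OF _ Y_joint, of "\<lambda>p. (fst (fst p), snd p)" "(M \<Otimes>\<^sub>M lborel) \<Otimes>\<^sub>M lborel"]
    by simp
  have "(\<lambda>x. \<integral>r. (if 0 \<le> r \<and> r \<le> snd x then 1 else 0) * (\<beta> r * Y r (fst x)) \<partial>lborel)
      \<in> borel_measurable (M \<Otimes>\<^sub>M lborel)"
    by (rule lborel.borel_measurable_lebesgue_integral) (simp add: case_prod_beta)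
  hence "(\<lambda>x. LINT r:{0..snd x}|lborel. \<beta> r * Y r (fst x)) \<in> borel_measurable (M \<Otimes>\<^sub>M lborel)"
    by (simp add: set_lebesgue_integral_def indicator_def of_bool_def)
  then show ?thesis unfolding f_eq by (intro borel_measurable_diff Y_joint)
qed

lemma Y_path_integrable: "set_integrable lborel {0..T} (\<lambda>s. \<beta> s * Y s \<omega>)"
  using continuous_on_subset[OF Y_continuous]
  by (intro set_integrable_mult_continuous \<beta>_integrable) auto

lemma f_continuous: "continuous_on {0..T} (\<lambda>s. f s \<omega>)"
  unfolding f_eq using continuous_on_subset[OF Y_continuous]
  by (intro continuous_intros continuous_on_indefinite_integral Y_path_integrable) auto

lemma abs_path_integrable:
  "set_integrable lborel {0..T} (\<lambda>s. \<bar>\<beta> s\<bar> * \<bar>Y s \<omega>\<bar>)" 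
  "set_integrable lborel {0..T} (\<lambda>s. \<bar>\<beta> s\<bar> * \<bar>f s \<omega>\<bar>)" 
  "set_integrable lborel {0..T} (\<lambda>s. \<bar>\<beta> s\<bar> * (f s \<omega>)\<^sup>2)"
  by (intro set_integrable_mult_continuous set_integrable_abs \<beta>_integrable continuous_intros f_continuous
      continuous_on_subset[OF Y_continuous subset_UNIV])+

text \<open>Pathwise \<open>(\<integral> \<bar>\<beta>\<bar> \<bar>f\<bar>)\<^sup>2 \<le> \<integral> \<bar>\<beta>\<bar> \<cdot> \<integral> \<bar>\<beta>\<bar> f\<^sup>2\<close>, and the expectation of the last integral is
  controlled by the second moments of \<open>f\<close>.\<close>

lemma weighted_f_square: "square_integrable M (\<lambda>\<omega>. LINT s:{0..T}|lborel. \<bar>\<beta> s\<bar> * \<bar>f s \<omega>\<bar>)"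
proof (rule square_integrableI_nn)
  note [measurable] = f_joint
  show "(\<lambda>\<omega>. LINT s:{0..T}|lborel. \<bar>\<beta> s\<bar> * \<bar>f s \<omega>\<bar>) \<in> borel_measurable M"
    unfolding set_lebesgue_integral_def
    by (rule lborel.borel_measurable_lebesgue_integral) (simp add: case_prod_beta)
  define I where "I = (LINT s:{0..T}|lborel. \<bar>\<beta> s\<bar>)"
  have I: "0 \<le> I" unfolding I_def set_lebesgue_integral_def by (intro Bochner_Integration.integral_nonneg) auto
  have ib: "integrable lborel (\<lambda>s. indicator {0..T} s * \<bar>\<beta> s\<bar>)"
    using set_integrable_abs[OF \<beta>_integrable[of T]] by (simp add: set_integrable_def)
  obtain C where C: "\<And>t. t \<in> {0..T} \<Longrightarrow> expectation (\<lambda>\<omega>. (f t \<omega>)\<^sup>2) \<le> C"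
    using f_bounded by blast
  have "(LINT s:{0..T}|lborel. \<bar>\<beta> s\<bar> * \<bar>f s \<omega>\<bar>)\<^sup>2 \<le> I * (LINT s:{0..T}|lborel. \<bar>\<beta> s\<bar> * (f s \<omega>)\<^sup>2)"
    if [measurable]: "\<omega> \<in> space M" for \<omega>
  proof -
    have [measurable]: "(\<lambda>s. f s \<omega>) \<in> borel_measurable lborel"
      using measurable_compose[OF measurable_Pair1'[OF that] f_joint] by simp
    define p where "p s = indicator {0..T} s * sqrt \<bar>\<beta> s\<bar>" for s
    define q where "q s = indicator {0..T} s * (sqrt \<bar>\<beta> s\<bar> * \<bar>f s \<omega>\<bar>)" for s
    have e: "(\<lambda>s. (p s)\<^sup>2) = (\<lambda>s. indicator {0..T} s * \<bar>\<beta> s\<bar>)" "(\<lambda>s. (q s)\<^sup>2) = (\<lambda>s. indicator {0..T} s * (\<bar>\<beta> s\<bar> * (f s \<omega>)\<^sup>2))"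
      "(\<lambda>s. p s * q s) = (\<lambda>s. indicator {0..T} s * (\<bar>\<beta> s\<bar> * \<bar>f s \<omega>\<bar>))"
      by (auto simp: p_def q_def power_mult_distrib indicator_def)
    have pq: "p \<in> borel_measurable lborel" "q \<in> borel_measurable lborel"
      unfolding p_def q_def by measurable
    have "square_integrable lborel p" "square_integrable lborel q"
      unfolding square_integrable_def e using ib abs_path_integrable(3)[of T \<omega>] pq
      by (simp_all add: set_integrable_def)
    from integral_Cauchy_Schwarz[OF this] show ?thesis
      unfolding e by (simp add: set_lebesgue_integral_def I_def)
  qed
  hence "(\<integral>\<^sup>+\<omega>. ennreal ((LINT s:{0..T}|lborel. \<bar>\<beta> s\<bar> * \<bar>f s \<omega>\<bar>)\<^sup>2) \<partial>M)
    \<le> (\<integral>\<^sup>+\<omega>. ennreal (I * (LINT s:{0..T}|lborel. \<bar>\<beta> s\<bar> * (f s \<omega>)\<^sup>2)) \<partial>M)"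
    by (intro nn_integral_mono ennreal_leI)
  also have "\<dots> = (\<integral>\<^sup>+\<omega>. ennreal I * (\<integral>\<^sup>+s. ennreal (indicator {0..T} s * (\<bar>\<beta> s\<bar> * (f s \<omega>)\<^sup>2)) \<partial>lborel) \<partial>M)"
  proof (rule nn_integral_cong)
    fix \<omega>
    have "(\<integral>\<^sup>+s. ennreal (indicator {0..T} s * (\<bar>\<beta> s\<bar> * (f s \<omega>)\<^sup>2)) \<partial>lborel)
      = ennreal (LINT s:{0..T}|lborel. \<bar>\<beta> s\<bar> * (f s \<omega>)\<^sup>2)"
      unfolding set_lebesgue_integral_def real_scaleR_def
      by (rule nn_integral_eq_integral) (use abs_path_integrable(3)[of T \<omega>] in \<open>auto simp: set_integrable_def\<close>)
    then show "ennreal (I * (LINT s:{0..T}|lborel. \<bar>\<beta> s\<bar> * (f s \<omega>)\<^sup>2))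
      = ennreal I * (\<integral>\<^sup>+s. ennreal (indicator {0..T} s * (\<bar>\<beta> s\<bar> * (f s \<omega>)\<^sup>2)) \<partial>lborel)"
      using ennreal_mult'[OF I] by simp
  qed
  also have "\<dots> = ennreal I * (\<integral>\<^sup>+\<omega>. (\<integral>\<^sup>+s. ennreal (indicator {0..T} s * (\<bar>\<beta> s\<bar> * (f s \<omega>)\<^sup>2)) \<partial>lborel) \<partial>M)"
    by (intro nn_integral_cmult lborel.borel_measurable_nn_integral) (simp add: case_prod_beta)
  also have "(\<integral>\<^sup>+\<omega>. (\<integral>\<^sup>+s. ennreal (indicator {0..T} s * (\<bar>\<beta> s\<bar> * (f s \<omega>)\<^sup>2)) \<partial>lborel) \<partial>M)
    = (\<integral>\<^sup>+s. (\<integral>\<^sup>+\<omega>. ennreal (indicator {0..T} s * (\<bar>\<beta> s\<bar> * (f s \<omega>)\<^sup>2)) \<partial>M) \<partial>lborel)"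
    by (rule P.Fubini'[symmetric]) (simp add: case_prod_beta)
  also have "\<dots> \<le> (\<integral>\<^sup>+s. ennreal (\<bar>C\<bar> * (indicator {0..T} s * \<bar>\<beta> s\<bar>)) \<partial>lborel)"
  proof (intro nn_integral_mono)
    fix s
    show "(\<integral>\<^sup>+\<omega>. ennreal (indicator {0..T} s * (\<bar>\<beta> s\<bar> * (f s \<omega>)\<^sup>2)) \<partial>M) \<le> ennreal (\<bar>C\<bar> * (indicator {0..T} s * \<bar>\<beta> s\<bar>))"
    proof (cases "s \<in> {0..T}")
      case True
      have sq: "square_integrable M (f s)" using f_square True by simp
      have "(\<integral>\<^sup>+\<omega>. ennreal (indicator {0..T} s * (\<bar>\<beta> s\<bar> * (f s \<omega>)\<^sup>2)) \<partial>M)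
        = ennreal \<bar>\<beta> s\<bar> * (\<integral>\<^sup>+\<omega>. ennreal ((f s \<omega>)\<^sup>2) \<partial>M)"
        using True square_integrable_measurable[OF sq]
        by (simp add: ennreal_mult' nn_integral_cmult)
      also have "\<dots> = ennreal (\<bar>\<beta> s\<bar> * expectation (\<lambda>\<omega>. (f s \<omega>)\<^sup>2))"
        unfolding nn_integral_square[OF sq] by (simp add: ennreal_mult')
      also have "\<dots> \<le> ennreal (\<bar>\<beta> s\<bar> * \<bar>C\<bar>)"
        using C[OF True] by (intro ennreal_leI mult_left_mono) auto
      finally show ?thesis using True by (simp add: mult.commute)
    qed simp
  qed
  also have "\<dots> = ennreal (\<integral>s. \<bar>C\<bar> * (indicator {0..T} s * \<bar>\<beta> s\<bar>) \<partial>lborel)"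
    by (intro nn_integral_eq_integral integrable_mult_right ib) auto
  finally have "(\<integral>\<^sup>+\<omega>. ennreal ((LINT s:{0..T}|lborel. \<bar>\<beta> s\<bar> * \<bar>f s \<omega>\<bar>)\<^sup>2) \<partial>M)
     \<le> ennreal I * ennreal (\<integral>s. \<bar>C\<bar> * (indicator {0..T} s * \<bar>\<beta> s\<bar>) \<partial>lborel)"
    by (simp add: mult_left_mono)
  also have "\<dots> < \<infinity>" by (simp add: ennreal_mult_less_top)
  finally show "(\<integral>\<^sup>+\<omega>. ennreal ((LINT s:{0..T}|lborel. \<bar>\<beta> s\<bar> * \<bar>f s \<omega>\<bar>)\<^sup>2) \<partial>M) < \<infinity>" .
qed

text \<open>The Gronwall inequality is applied to each path; its constant is deterministic.\<close>

lemma weighted_Y_square: "square_integrable M (\<lambda>\<omega>. LINT s:{0..T}|lborel. \<bar>\<beta> s\<bar> * \<bar>Y s \<omega>\<bar>)"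
proof -
  let ?A = "\<lambda>\<omega>. LINT s:{0..T}|lborel. \<bar>\<beta> s\<bar> * \<bar>Y s \<omega>\<bar>"
  have meas: "?A \<in> borel_measurable M"
    unfolding set_lebesgue_integral_def
    by (rule lborel.borel_measurable_lebesgue_integral) (simp add: case_prod_beta)
  obtain K where K: "\<forall>x f. set_integrable lborel {0..T} (\<lambda>s. \<bar>\<beta> s\<bar> * x s) \<longrightarrow>
    set_integrable lborel {0..T} (\<lambda>s. \<bar>\<beta> s\<bar> * f s) \<longrightarrow>
    (\<forall>s\<in>{0..T}. 0 \<le> x s) \<longrightarrow> (\<forall>s\<in>{0..T}. 0 \<le> f s) \<longrightarrow>
    (\<forall>s\<in>{0..T}. x s \<le> f s + (LINT r:{0..s}|lborel. \<bar>\<beta> r\<bar> * x r)) \<longrightarrow>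
    (LINT s:{0..T}|lborel. \<bar>\<beta> s\<bar> * x s) \<le> K * (LINT s:{0..T}|lborel. \<bar>\<beta> s\<bar> * f s)"
    using gronwall_integral[OF set_integrable_abs[OF \<beta>_integrable[of T]] abs_ge_zero] by blast
  have bound: "?A \<omega> \<le> K * (LINT s:{0..T}|lborel. \<bar>\<beta> s\<bar> * \<bar>f s \<omega>\<bar>)" for \<omega>
  proof (intro K[rule_format] abs_path_integrable)
    fix s
    have "Y s \<omega> = f s \<omega> + (LINT r:{0..s}|lborel. \<beta> r * Y r \<omega>)" by (simp add: f_eq)
    hence "\<bar>Y s \<omega>\<bar> \<le> \<bar>f s \<omega>\<bar> + \<bar>LINT r:{0..s}|lborel. \<beta> r * Y r \<omega>\<bar>" by linarith
    also have "\<bar>LINT r:{0..s}|lborel. \<beta> r * Y r \<omega>\<bar> \<le> (LINT r:{0..s}|lborel. \<bar>\<beta> r\<bar> * \<bar>Y r \<omega>\<bar>)"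
      unfolding set_lebesgue_integral_def
      by (rule order_trans[OF integral_abs_bound]) (simp add: abs_mult)
    finally show "\<bar>Y s \<omega>\<bar> \<le> \<bar>f s \<omega>\<bar> + (LINT r:{0..s}|lborel. \<bar>\<beta> r\<bar> * \<bar>Y r \<omega>\<bar>)" by simp
  qed auto
  have nonneg: "0 \<le> ?A \<omega>" for \<omega>
    unfolding set_lebesgue_integral_def by (intro Bochner_Integration.integral_nonneg) auto
  note sq = square_integrable_cmult[OF weighted_f_square[of T], of K]
  show ?thesis
    using bound nonneg by (intro square_integrable_bound[OF sq meas]) (auto intro: order_trans[OF _ abs_ge_self])
qed

lemma product_integrable:
  assumes "square_integrable M N"
  shows "integrable (M \<Otimes>\<^sub>M lborel) (\<lambda>(\<omega>, s). indicator {0..T} s * (\<beta> s * (N \<omega> * Y s \<omega>)))"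
proof (rule P.Fubini_integrable)
  have [measurable]: "N \<in> borel_measurable M" using assms by (rule square_integrable_measurable)
  show "(\<lambda>(\<omega>, s). indicator {0..T} s * (\<beta> s * (N \<omega> * Y s \<omega>))) \<in> borel_measurable (M \<Otimes>\<^sub>M lborel)"
    by (simp add: case_prod_beta)
  have "(\<integral>s. norm (case (\<omega>, s) of (\<omega>, s) \<Rightarrow> indicator {0..T} s * (\<beta> s * (N \<omega> * Y s \<omega>))) \<partial>lborel)
    = \<bar>N \<omega>\<bar> * (LINT s:{0..T}|lborel. \<bar>\<beta> s\<bar> * \<bar>Y s \<omega>\<bar>)" for \<omega>
  proof -
    have "(\<integral>s. norm (case (\<omega>, s) of (\<omega>, s) \<Rightarrow> indicator {0..T} s * (\<beta> s * (N \<omega> * Y s \<omega>))) \<partial>lborel)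
      = (\<integral>s. \<bar>N \<omega>\<bar> * (indicator {0..T} s * (\<bar>\<beta> s\<bar> * \<bar>Y s \<omega>\<bar>)) \<partial>lborel)"
      by (simp add: abs_mult mult_ac)
    then show ?thesis by (simp add: set_lebesgue_integral_def)
  qed
  then show "integrable M (\<lambda>\<omega>. \<integral>s. norm (case (\<omega>, s) of (\<omega>, s) \<Rightarrow> indicator {0..T} s * (\<beta> s * (N \<omega> * Y s \<omega>))) \<partial>lborel)"
    using square_integrable_mult[OF square_integrable_abs[OF assms] weighted_Y_square[of T]] by simp
  show "AE \<omega> in M. integrable lborel (\<lambda>s. case (\<omega>, s) of (\<omega>, s) \<Rightarrow> indicator {0..T} s * (\<beta> s * (N \<omega> * Y s \<omega>)))"
  proof (intro AE_I2)
    fix \<omega>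
    have "integrable lborel (\<lambda>s. N \<omega> * (indicator {0..T} s * (\<beta> s * Y s \<omega>)))"
      using Y_path_integrable[of T \<omega>] by (simp add: set_integrable_def)
    then show "integrable lborel (\<lambda>s. case (\<omega>, s) of (\<omega>, s) \<Rightarrow> indicator {0..T} s * (\<beta> s * (N \<omega> * Y s \<omega>)))"
      by (simp add: mult_ac)
  qed
qed

lemma Y_square:
  assumes "0 \<le> t"
  shows "square_integrable M (Y t)"
proof -
  let ?I = "\<lambda>\<omega>. LINT s:{0..t}|lborel. \<beta> s * Y s \<omega>"
  have I_eq: "?I = (\<lambda>\<omega>. Y t \<omega> - f t \<omega>)" by (simp add: f_eq)
  have meas: "?I \<in> borel_measurable M"
    unfolding I_eq by (intro borel_measurable_diff Y_measurable square_integrable_measurable f_square assms)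
  have "square_integrable M ?I"
  proof (rule square_integrable_bound[OF weighted_Y_square[of t] meas])
    fix \<omega>
    have "\<bar>?I \<omega>\<bar> \<le> (LINT r:{0..t}|lborel. \<bar>\<beta> r\<bar> * \<bar>Y r \<omega>\<bar>)"
      unfolding set_lebesgue_integral_def
      by (rule order_trans[OF integral_abs_bound]) (simp add: abs_mult)
    then show "\<bar>?I \<omega>\<bar> \<le> \<bar>LINT r:{0..t}|lborel. \<bar>\<beta> r\<bar> * \<bar>Y r \<omega>\<bar>\<bar>" by linarith
  qed
  from square_integrable_add[OF f_square[OF assms] this] show ?thesis by (simp add: f_eq)
qed

text \<open>Multiplying the equation with \<open>N\<close> and taking expectations turns it into a deterministic
  equation with the same coefficient.\<close>

lemma expectation_volterra:
  assumes N: "square_integrable M N"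
  shows "set_integrable lborel {0..t} (\<lambda>s. \<beta> s * expectation (\<lambda>\<omega>. N \<omega> * Y s \<omega>))"
    and "0 \<le> t \<Longrightarrow> expectation (\<lambda>\<omega>. N \<omega> * Y t \<omega>) = expectation (\<lambda>\<omega>. N \<omega> * f t \<omega>)
       + (LINT s:{0..t}|lborel. \<beta> s * expectation (\<lambda>\<omega>. N \<omega> * Y s \<omega>))"
proof -
  note int = product_integrable[OF N, of t]
  have "integrable lborel (\<lambda>s. \<integral>\<omega>. indicator {0..t} s * (\<beta> s * (N \<omega> * Y s \<omega>)) \<partial>M)"
    using P.integrable_snd[OF int] .
  then show "set_integrable lborel {0..t} (\<lambda>s. \<beta> s * expectation (\<lambda>\<omega>. N \<omega> * Y s \<omega>))"
    by (simp add: set_integrable_def)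
  assume t: "0 \<le> t"
  have "(LINT s:{0..t}|lborel. \<beta> s * expectation (\<lambda>\<omega>. N \<omega> * Y s \<omega>))
    = (\<integral>s. (\<integral>\<omega>. indicator {0..t} s * (\<beta> s * (N \<omega> * Y s \<omega>)) \<partial>M) \<partial>lborel)"
    by (simp add: set_lebesgue_integral_def)
  also have "\<dots> = (\<integral>\<omega>. (\<integral>s. indicator {0..t} s * (\<beta> s * (N \<omega> * Y s \<omega>)) \<partial>lborel) \<partial>M)"
    by (rule P.Fubini_integral[OF int])
  also have "\<dots> = expectation (\<lambda>\<omega>. N \<omega> * (Y t \<omega> - f t \<omega>))"
  proof (intro Bochner_Integration.integral_cong refl)
    fix \<omega>
    have "(\<integral>s. indicator {0..t} s * (\<beta> s * (N \<omega> * Y s \<omega>)) \<partial>lborel)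
      = (\<integral>s. N \<omega> * (indicator {0..t} s * (\<beta> s * Y s \<omega>)) \<partial>lborel)" by (simp add: mult_ac)
    also have "\<dots> = N \<omega> * (Y t \<omega> - f t \<omega>)" by (simp add: f_eq set_lebesgue_integral_def)
    finally show "(\<integral>s. indicator {0..t} s * (\<beta> s * (N \<omega> * Y s \<omega>)) \<partial>lborel) = N \<omega> * (Y t \<omega> - f t \<omega>)" .
  qed
  also have "\<dots> = expectation (\<lambda>\<omega>. N \<omega> * Y t \<omega>) - expectation (\<lambda>\<omega>. N \<omega> * f t \<omega>)"
    using square_integrable_mult[OF N Y_square[OF t]] square_integrable_mult[OF N f_square[OF t]]
    by (simp add: right_diff_distrib)
  finally show "expectation (\<lambda>\<omega>. N \<omega> * Y t \<omega>) = expectation (\<lambda>\<omega>. N \<omega> * f t \<omega>)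
       + (LINT s:{0..t}|lborel. \<beta> s * expectation (\<lambda>\<omega>. N \<omega> * Y s \<omega>))" by simp
qed

end

section \<open>The linear stochastic differential equation\<close>

text \<open>The coefficients are Lebesgue measurable, and product measurability with respect to paths is
  more convenient for Borel functions.\<close>

lemma borel_representative:
  fixes f :: "real \<Rightarrow> real"
  assumes f: "\<And>T. 0 \<le> T \<Longrightarrow> f absolutely_integrable_on {0..T}"
  obtains g where "g \<in> borel_measurable borel" "AE s in lebesgue. 0 \<le> s \<longrightarrow> f s = g s"
    "\<And>T. set_integrable lborel {0..T} g"
proof -
  have meas: "(\<lambda>s. indicator {0..} s * f s) \<in> borel_measurable lebesgue"
  proof (rule borel_measurable_LIMSEQ_real)
    show "(\<lambda>n. indicator {0..real n} s * f s) \<longlonglongrightarrow> indicator {0..} s * f s" for s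
    proof (rule tendsto_eventually)
      obtain m where m: "s \<le> real m" using real_arch_simple by blast
      have "indicator {0..real n} s * f s = indicator {0..} s * f s" if "m \<le> n" for n
        using m that by (auto simp: indicator_def)
      then show "\<forall>\<^sub>F n in sequentially. indicator {0..real n} s * f s = indicator {0..} s * f s"
        unfolding eventually_sequentially by blast
    qed
    show "(\<lambda>s. indicator {0..real n} s * f s) \<in> borel_measurable lebesgue" for n
      using f[of "real n"] by (auto simp: set_integrable_def)
  qed
  from completion_ex_borel_measurable_real[OF meas]
  obtain g where g: "g \<in> borel_measurable lborel" "AE s in lborel. indicator {0..} s * f s = g s" by blast
  from AE_completion[OF g(2)] have ae: "AE s in lebesgue. 0 \<le> s \<longrightarrow> f s = g s"
    by eventually_elim (auto simp: indicator_def split: if_splits)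
  have "set_integrable lborel {0..T} g" for T
  proof (cases "0 \<le> T")
    case True
    have [measurable]: "g \<in> borel_measurable borel" using g(1) by simp
    have gm: "(\<lambda>s. indicator {0..T} s *\<^sub>R g s) \<in> borel_measurable lborel"
      by measurable
    have "integrable lebesgue (\<lambda>s. indicator {0..T} s *\<^sub>R g s)"
    proof (rule integrable_cong_AE_imp)
      show "integrable lebesgue (\<lambda>s. indicator {0..T} s *\<^sub>R f s)"
        using f[OF True] by (simp add: set_integrable_def)
      show "(\<lambda>s. indicator {0..T} s *\<^sub>R g s) \<in> borel_measurable lebesgue"
        using gm by (rule measurable_completion)
      show "AE s in lebesgue. indicator {0..T} s *\<^sub>R f s = indicator {0..T} s *\<^sub>R g s"
        using ae by eventually_elim (auto simp: indicator_def)
    qed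
    then show ?thesis unfolding set_integrable_def using integrable_completion[OF gm] by simp
  qed (simp add: set_integrable_def)
  then show thesis using that[of g] g(1) ae by simp
qed

lemma set_integrable_square_imp_integrable_indicator:
  fixes r :: "real \<Rightarrow> real"
  assumes "r \<in> borel_measurable borel" "set_integrable lborel {0..s} (\<lambda>q. (r q)\<^sup>2)"
  shows "integrable lborel (\<lambda>q. indicator {u<..t} q * (indicator {0..s} q * r q))"
proof (rule square_integrable_mult[OF square_integrable_indicator_Ioc])
  have "(\<lambda>q. (indicator {0..s} q * r q)\<^sup>2) = (\<lambda>q. indicator {0..s} q *\<^sub>R (r q)\<^sup>2)"
    by (auto simp: indicator_def)
  then show "square_integrable lborel (\<lambda>q. indicator {0..s} q * r q)"
    using assms by (simp add: square_integrable_def set_integrable_def)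
qed

context wiener
begin

text \<open>\<open>Y\<close> is the solution with a null set of discontinuous paths removed and extended by its
  initial value to negative times. For each \<open>t\<close> the difference \<open>f t = Y t - \<integral>\<^sub>0\<^sup>t \<beta> Y\<close> agrees almost
  surely with a constant plus a Wiener integral of \<open>\<sigma>\<close>, whose moments are known.\<close>

lemma linear_sde_volterra:
  assumes sde: "solves_linear_sde M W a b \<sigma> x0 X"
    and a_int: "\<And>T. 0 \<le> T \<Longrightarrow> a absolutely_integrable_on {0..T}"
    and b_int: "\<And>T. 0 \<le> T \<Longrightarrow> b absolutely_integrable_on {0..T}"
    and \<sigma>_int: "\<And>T. 0 \<le> T \<Longrightarrow> (\<lambda>t. (\<sigma> t)\<^sup>2) absolutely_integrable_on {0..T}"
    and \<sigma>_pos: "AE t in lebesgue. 0 \<le> t \<longrightarrow> 0 < \<sigma> t"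
  obtains Y \<beta> f r where "volterra M Y \<beta> f" "\<And>s. 0 \<le> s \<Longrightarrow> AE \<omega> in M. Y s \<omega> = X s \<omega>"
    "r \<in> borel_measurable borel" "AE s in lborel. 0 \<le> s \<longrightarrow> 0 < r s"
    "\<And>T. set_integrable lborel {0..T} (\<lambda>s. (r s)\<^sup>2)"
    "\<And>u v t. 0 \<le> u \<Longrightarrow> u \<le> v \<Longrightarrow> 0 \<le> t \<Longrightarrow> expectation (\<lambda>\<omega>. (W v \<omega> - W u \<omega>) * f t \<omega>)
       = (LINT s|lborel. indicator {u<..v} s * (indicator {0..t} s * r s))"
proof -
  obtain \<alpha> where \<alpha> [measurable]: "\<alpha> \<in> borel_measurable borel" and a\<alpha>: "AE s in lebesgue. 0 \<le> s \<longrightarrow> a s = \<alpha> s"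
    and \<alpha>_int: "\<And>T. set_integrable lborel {0..T} \<alpha>"
    using borel_representative[OF a_int] by blast
  obtain \<beta> where \<beta> [measurable]: "\<beta> \<in> borel_measurable borel" and b\<beta>: "AE s in lebesgue. 0 \<le> s \<longrightarrow> b s = \<beta> s"
    and \<beta>_int: "\<And>T. set_integrable lborel {0..T} \<beta>"
    using borel_representative[OF b_int] by blast
  obtain v where v [measurable]: "v \<in> borel_measurable borel" and \<sigma>v: "AE s in lebesgue. 0 \<le> s \<longrightarrow> (\<sigma> s)\<^sup>2 = v s"
    and v_int: "\<And>T. set_integrable lborel {0..T} v"
    using borel_representative[OF \<sigma>_int] by blast
  \<comment> \<open>The absolute value is there because \<open>v\<close> may be negative on a null set.\<close>
  define r where "r s = sqrt \<bar>v s\<bar>" for s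
  have r [measurable]: "r \<in> borel_measurable borel" unfolding r_def by measurable
  have r_square: "set_integrable lborel {0..T} (\<lambda>s. (r s)\<^sup>2)" for T
    using set_integrable_abs[OF v_int[of T]] by (simp add: r_def)
  have \<sigma>r: "AE s in lebesgue. 0 \<le> s \<longrightarrow> \<sigma> s = r s \<and> 0 < r s"
    using \<sigma>v \<sigma>_pos
  proof eventually_elim
    case (elim s)
    show ?case
    proof
      assume s: "0 \<le> s"
      with elim have "v s = (\<sigma> s)\<^sup>2" "0 < \<sigma> s" by auto
      then show "\<sigma> s = r s \<and> 0 < r s" by (simp add: r_def)
    qed
  qed
  hence r_pos: "AE s in lborel. 0 \<le> s \<longrightarrow> 0 < r s"
    unfolding AE_completion_iff by eventually_elim simp
  have \<sigma>_r: "AE s in lebesgue. 0 \<le> s \<longrightarrow> \<sigma> s = r s"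
    using \<sigma>r by eventually_elim simp
  from sde have X_meas: "\<And>t. 0 \<le> t \<Longrightarrow> X t \<in> borel_measurable M"
    and X_cont: "AE \<omega> in M. continuous_on {0..} (\<lambda>t. X t \<omega>)"
    and X_eq: "\<And>t. 0 \<le> t \<Longrightarrow> \<exists>Z. has_wiener_integral M W \<sigma> t Z \<and>
        (AE \<omega> in M. X t \<omega> = x0 + (LINT s:{0..t}|lebesgue. a s + b s * X s \<omega>) + Z \<omega>)"
    unfolding solves_linear_sde_def by auto
  from AE_E[OF X_cont] obtain N0 where N0_sub: "{\<omega> \<in> space M. \<not> continuous_on {0..} (\<lambda>t. X t \<omega>)} \<subseteq> N0"
    and N0: "emeasure M N0 = 0" "N0 \<in> sets M" by blast
  define Y where "Y s \<omega> = indicator (space M - N0) \<omega> * X (max 0 s) \<omega>" for s \<omega>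
  have Y_meas: "Y s \<in> borel_measurable M" for s
    unfolding Y_def using X_meas[of "max 0 s"] N0 by measurable
  have Y_cont: "continuous_on UNIV (\<lambda>s. Y s \<omega>)" for \<omega>
  proof (cases "\<omega> \<in> space M - N0")
    case True
    hence "continuous_on {0..} (\<lambda>t. X t \<omega>)" using N0_sub by blast
    hence "continuous_on UNIV (\<lambda>s. X (max 0 s) \<omega>)"
      by (rule continuous_on_compose2[OF _ continuous_on_max[OF continuous_on_const continuous_on_id]]) auto
    then show ?thesis using True by (simp add: Y_def)
  qed (simp add: Y_def)
  have good: "AE \<omega> in M. \<omega> \<in> space M - N0"
    using AE_not_in[of N0 M] N0 by (auto simp: null_sets_def)
  have Y_X: "Y s \<omega> = X s \<omega>" if "\<omega> \<in> space M - N0" "0 \<le> s" for s \<omega>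
    using that by (simp add: Y_def)
  define f where "f t \<omega> = Y t \<omega> - (LINT s:{0..t}|lborel. \<beta> s * Y s \<omega>)" for t \<omega>
  define \<kappa> where "\<kappa> t = x0 + (LINT s:{0..t}|lborel. \<alpha> s)" for t
  have f_meas: "f t \<in> borel_measurable M" for t
  proof -
    have [measurable]: "(\<lambda>x. Y (snd x) (fst x)) \<in> borel_measurable (M \<Otimes>\<^sub>M lborel)"
      using continuous_process_measurable[of Y M] Y_meas Y_cont by (simp add: case_prod_beta)
    have "(\<lambda>\<omega>. LINT s:{0..t}|lborel. \<beta> s * Y s \<omega>) \<in> borel_measurable M"
      unfolding set_lebesgue_integral_def
      by (rule lborel.borel_measurable_lebesgue_integral) (simp add: case_prod_beta)
    then show ?thesis unfolding f_def by (intro borel_measurable_diff Y_meas)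
  qed
  have drift: "(LINT s:{0..t}|lebesgue. a s + b s * X s \<omega>)
      = (LINT s:{0..t}|lborel. \<alpha> s) + (LINT s:{0..t}|lborel. \<beta> s * Y s \<omega>)"
    if t: "0 \<le> t" and \<omega>: "\<omega> \<in> space M - N0" for t \<omega>
  proof -
    have [measurable]: "(\<lambda>s. Y s \<omega>) \<in> borel_measurable borel"
      by (rule borel_measurable_continuous_onI[OF Y_cont])
    have Yl: "(\<lambda>s. Y s \<omega>) \<in> borel_measurable lebesgue"
      by (rule measurable_completion) simp
    have bY: "set_integrable lborel {0..t} (\<lambda>s. \<beta> s * Y s \<omega>)"
      using continuous_on_subset[OF Y_cont] by (intro set_integrable_mult_continuous \<beta>_int) auto
    have borel: "(\<lambda>s. indicator {0..t} s *\<^sub>R (\<alpha> s + \<beta> s * Y s \<omega>)) \<in> borel_measurable lborel"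
      by measurable
    have eq: "(\<lambda>s. indicator {0..t} s *\<^sub>R (a s + b s * X s \<omega>))
      = (\<lambda>s. indicator {0..t} s *\<^sub>R a s + indicator {0..t} s *\<^sub>R b s * Y s \<omega>)"
      using Y_X[OF \<omega>] by (auto simp: indicator_def fun_eq_iff)
    have "(LINT s:{0..t}|lebesgue. a s + b s * X s \<omega>)
      = (\<integral>s. indicator {0..t} s *\<^sub>R (\<alpha> s + \<beta> s * Y s \<omega>) \<partial>lebesgue)"
      unfolding set_lebesgue_integral_def
    proof (rule integral_cong_AE)
      show "(\<lambda>s. indicator {0..t} s *\<^sub>R (a s + b s * X s \<omega>)) \<in> borel_measurable lebesgue"
        unfolding eq using a_int[OF t] b_int[OF t]
        by (intro borel_measurable_add borel_measurable_times Yl) (auto simp: set_integrable_def)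
      show "(\<lambda>s. indicator {0..t} s *\<^sub>R (\<alpha> s + \<beta> s * Y s \<omega>)) \<in> borel_measurable lebesgue"
        using borel by (rule measurable_completion)
      show "AE s in lebesgue. indicator {0..t} s *\<^sub>R (a s + b s * X s \<omega>)
          = indicator {0..t} s *\<^sub>R (\<alpha> s + \<beta> s * Y s \<omega>)"
        using a\<alpha> b\<beta> by eventually_elim (use Y_X[OF \<omega>] in \<open>auto simp: indicator_def\<close>)
    qed
    also have "\<dots> = (LINT s:{0..t}|lborel. \<alpha> s + \<beta> s * Y s \<omega>)"
      unfolding set_lebesgue_integral_def by (rule integral_completion[OF borel])
    also have "\<dots> = (LINT s:{0..t}|lborel. \<alpha> s) + (LINT s:{0..t}|lborel. \<beta> s * Y s \<omega>)"
      by (rule set_integral_add(2)[OF \<alpha>_int bY])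
    finally show ?thesis .
  qed
  have f_eq: "\<exists>Z. has_wiener_integral M W \<sigma> t Z \<and> (AE \<omega> in M. \<kappa> t + Z \<omega> = f t \<omega>)" if t: "0 \<le> t" for t
  proof -
    from X_eq[OF t] obtain Z where Z: "has_wiener_integral M W \<sigma> t Z"
      and ae: "AE \<omega> in M. X t \<omega> = x0 + (LINT s:{0..t}|lebesgue. a s + b s * X s \<omega>) + Z \<omega>" by blast
    from ae good have "AE \<omega> in M. \<kappa> t + Z \<omega> = f t \<omega>"
    proof eventually_elim
      case (elim \<omega>)
      then show ?case using drift[OF t] Y_X[of \<omega> t] t by (simp add: f_def \<kappa>_def)
    qed
    with Z show ?thesis by blast
  qed
  have f_square: "square_integrable M (f t)" if "0 \<le> t" for t
  proof -
    from f_eq[OF that] obtain Z where Z: "has_wiener_integral M W \<sigma> t Z" and ae: "AE \<omega> in M. \<kappa> t + Z \<omega> = f t \<omega>"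
      by blast
    show ?thesis
      by (rule square_integrable_cong_AE[OF square_integrable_add[OF square_integrable_const
            wiener_integral(1)[OF Z r \<sigma>_r r_square]] f_meas ae])
  qed
  have f_cov: "expectation (\<lambda>\<omega>. (W v \<omega> - W u \<omega>) * f t \<omega>)
       = (LINT s|lborel. indicator {u<..v} s * (indicator {0..t} s * r s))"
    if uv: "0 \<le> u" "u \<le> v" and t: "0 \<le> t" for u v t
  proof -
    from f_eq[OF t] obtain Z where Z: "has_wiener_integral M W \<sigma> t Z" and ae: "AE \<omega> in M. \<kappa> t + Z \<omega> = f t \<omega>"
      by blast
    note Zsq = wiener_integral(1)[OF Z r \<sigma>_r r_square] and Wsq = W_increment(1)[OF uv]
    have [measurable]: "Z \<in> borel_measurable M" "f t \<in> borel_measurable M" "(\<lambda>\<omega>. W v \<omega> - W u \<omega>) \<in> borel_measurable M"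
      using Zsq Wsq f_meas by (auto simp: square_integrable_def)
    have "expectation (\<lambda>\<omega>. (W v \<omega> - W u \<omega>) * f t \<omega>) = expectation (\<lambda>\<omega>. \<kappa> t * (W v \<omega> - W u \<omega>) + (W v \<omega> - W u \<omega>) * Z \<omega>)"
    proof (rule integral_cong_AE)
      show "AE \<omega> in M. (W v \<omega> - W u \<omega>) * f t \<omega> = \<kappa> t * (W v \<omega> - W u \<omega>) + (W v \<omega> - W u \<omega>) * Z \<omega>"
        using ae
      proof eventually_elim
        case (elim \<omega>)
        then show ?case unfolding elim[symmetric] by (simp add: algebra_simps)
      qed
    qed measurable
    also have "\<dots> = expectation (\<lambda>\<omega>. \<kappa> t * (W v \<omega> - W u \<omega>)) + expectation (\<lambda>\<omega>. (W v \<omega> - W u \<omega>) * Z \<omega>)"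
      by (intro Bochner_Integration.integral_add integrable_mult_right
          square_integrable_integrable square_integrable_mult Zsq Wsq)
    also have "expectation (\<lambda>\<omega>. \<kappa> t * (W v \<omega> - W u \<omega>)) = 0"
      using W_increment(2)[OF uv] by simp
    also have "expectation (\<lambda>\<omega>. (W v \<omega> - W u \<omega>) * Z \<omega>)
        = (LINT s|lborel. indicator {u<..v} s * (indicator {0..t} s * r s))"
      by (rule wiener_integral(3)[OF Z r \<sigma>_r r_square uv])
    finally show ?thesis by simp
  qed
  have f_bound: "\<exists>C. \<forall>t\<in>{0..T}. expectation (\<lambda>\<omega>. (f t \<omega>)\<^sup>2) \<le> C" for T
  proof (intro exI ballI)
    fix t assume t: "t \<in> {0..T}"
    from f_eq t obtain Z where Z: "has_wiener_integral M W \<sigma> t Z" and ae: "AE \<omega> in M. \<kappa> t + Z \<omega> = f t \<omega>"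
      by force
    note Zsq = wiener_integral(1)[OF Z r \<sigma>_r r_square]
    have [measurable]: "Z \<in> borel_measurable M" "f t \<in> borel_measurable M"
      using Zsq f_meas by (auto simp: square_integrable_def)
    have Z2: "integrable M (\<lambda>\<omega>. (Z \<omega>)\<^sup>2)" using Zsq by (simp add: square_integrable_def)
    have mono: "(LINT s:{0..t}|lborel. \<phi> s) \<le> (LINT s:{0..T}|lborel. \<phi> s)"
      if "set_integrable lborel {0..T} \<phi>" "\<And>s. 0 \<le> \<phi> s" for \<phi> :: "real \<Rightarrow> real"
    proof -
      have "0 \<le> (LINT s:{t<..T}|lborel. \<phi> s)"
        unfolding set_lebesgue_integral_def by (intro Bochner_Integration.integral_nonneg) (simp add: that(2))
      then show ?thesis using set_integral_split[OF that(1), of t] t by simp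
    qed
    have "expectation (\<lambda>\<omega>. (f t \<omega>)\<^sup>2) \<le> expectation (\<lambda>\<omega>. 2 * (\<kappa> t)\<^sup>2 + 2 * (Z \<omega>)\<^sup>2)"
    proof (rule integral_mono_AE)
      show "AE \<omega> in M. (f t \<omega>)\<^sup>2 \<le> 2 * (\<kappa> t)\<^sup>2 + 2 * (Z \<omega>)\<^sup>2"
        using ae
      proof eventually_elim
        case (elim \<omega>)
        have "(\<kappa> t + Z \<omega>)\<^sup>2 \<le> 2 * (\<kappa> t)\<^sup>2 + 2 * (Z \<omega>)\<^sup>2"
          using zero_le_power2[of "\<kappa> t - Z \<omega>"] by (simp add: power2_eq_square algebra_simps)
        then show ?case using elim by simp
      qed
    qed (use f_square t Z2 in \<open>auto simp: square_integrable_def\<close>)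
    also have "\<dots> = 2 * (\<kappa> t)\<^sup>2 + 2 * expectation (\<lambda>\<omega>. (Z \<omega>)\<^sup>2)"
      using Z2 by (simp add: prob_space)
    also have "\<dots> \<le> 2 * (\<bar>x0\<bar> + (LINT s:{0..T}|lborel. \<bar>\<alpha> s\<bar>))\<^sup>2 + 2 * (4 * (LINT s:{0..T}|lborel. (r s)\<^sup>2))"
    proof (intro add_mono mult_left_mono)
      have "\<bar>\<kappa> t\<bar> \<le> \<bar>x0\<bar> + \<bar>LINT s:{0..t}|lborel. \<alpha> s\<bar>" unfolding \<kappa>_def by (rule abs_triangle_ineq)
      also have "\<bar>LINT s:{0..t}|lborel. \<alpha> s\<bar> \<le> (LINT s:{0..t}|lborel. \<bar>\<alpha> s\<bar>)"
        unfolding set_lebesgue_integral_def by (rule order_trans[OF integral_abs_bound]) (simp add: abs_mult)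
      also have "\<dots> \<le> (LINT s:{0..T}|lborel. \<bar>\<alpha> s\<bar>)"
        by (rule mono[OF set_integrable_abs[OF \<alpha>_int]]) simp
      finally have "\<bar>\<kappa> t\<bar> \<le> \<bar>x0\<bar> + (LINT s:{0..T}|lborel. \<bar>\<alpha> s\<bar>)" by simp
      from power_mono[OF this abs_ge_zero, of 2]
      show "(\<kappa> t)\<^sup>2 \<le> (\<bar>x0\<bar> + (LINT s:{0..T}|lborel. \<bar>\<alpha> s\<bar>))\<^sup>2" by simp
      show "expectation (\<lambda>\<omega>. (Z \<omega>)\<^sup>2) \<le> 4 * (LINT s:{0..T}|lborel. (r s)\<^sup>2)"
        using wiener_integral(2)[OF Z r \<sigma>_r r_square] mono[OF r_square[of T]] by simp
    qed auto
    finally show "expectation (\<lambda>\<omega>. (f t \<omega>)\<^sup>2)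
      \<le> 2 * (\<bar>x0\<bar> + (LINT s:{0..T}|lborel. \<bar>\<alpha> s\<bar>))\<^sup>2 + 2 * (4 * (LINT s:{0..T}|lborel. (r s)\<^sup>2))" .
  qed
  show thesis
  proof (rule that[OF _ _ r r_pos r_square f_cov])
    show "volterra M Y \<beta> f"
      by unfold_locales (use Y_meas Y_cont \<beta> \<beta>_int f_def f_square f_bound in blast)+
    show "AE \<omega> in M. Y s \<omega> = X s \<omega>" if "0 \<le> s" for s
      using good by eventually_elim (rule Y_X[OF _ that])
  qed
qed

text \<open>The test variable is \<open>N = W t - W w\<close> with \<open>u \<le> w < t\<close>. With \<open>h s = E (N Y s)\<close> and
  \<open>g s = E (N f s)\<close> one has \<open>h = g + \<integral> \<beta> h\<close>, where \<open>g\<close> vanishes up to \<open>w\<close>, is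
  nondecreasing, and \<open>g t > 0\<close>. Gronwall gives \<open>\<integral>\<^sub>0\<^sup>t \<bar>\<beta> h\<bar> \<le> K g t \<integral>\<^sub>w\<^sup>t \<bar>\<beta>\<bar>\<close>, which is less than \<open>g t\<close> for \<open>w\<close> close to \<open>t\<close>;
  the integral then cannot cancel \<open>g t\<close> in the equation for \<open>h t\<close>.\<close>

lemma volterra_nondegenerate:
  assumes V: "volterra M Y \<beta> f"
    and r: "r \<in> borel_measurable borel" and r_pos: "AE s in lborel. 0 \<le> s \<longrightarrow> 0 < r s"
    and r_square: "\<And>T. set_integrable lborel {0..T} (\<lambda>s. (r s)\<^sup>2)"
    and f_cov: "\<And>u v t. 0 \<le> u \<Longrightarrow> u \<le> v \<Longrightarrow> 0 \<le> t \<Longrightarrow> expectation (\<lambda>\<omega>. (W v \<omega> - W u \<omega>) * f t \<omega>)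
       = (LINT s|lborel. indicator {u<..v} s * (indicator {0..t} s * r s))"
    and ut: "0 \<le> u" "u < t"
  obtains N where "square_integrable M N" "expectation N = 0"
    "\<And>s. 0 \<le> s \<Longrightarrow> s \<le> u \<Longrightarrow> expectation (\<lambda>\<omega>. N \<omega> * Y s \<omega>) = 0"
    "expectation (\<lambda>\<omega>. N \<omega> * Y t \<omega>) \<noteq> 0"
proof -
  interpret V: volterra M Y \<beta> f by (rule V)
  have abs\<beta>: "set_integrable lborel {0..T} (\<lambda>s. \<bar>\<beta> s\<bar>)" for T
    by (rule set_integrable_abs[OF V.\<beta>_integrable])
  obtain K where K0: "0 \<le> K" and K: "\<forall>x f. set_integrable lborel {0..t} (\<lambda>s. \<bar>\<beta> s\<bar> * x s) \<longrightarrow>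
    set_integrable lborel {0..t} (\<lambda>s. \<bar>\<beta> s\<bar> * f s) \<longrightarrow>
    (\<forall>s\<in>{0..t}. 0 \<le> x s) \<longrightarrow> (\<forall>s\<in>{0..t}. 0 \<le> f s) \<longrightarrow>
    (\<forall>s\<in>{0..t}. x s \<le> f s + (LINT r:{0..s}|lborel. \<bar>\<beta> r\<bar> * x r)) \<longrightarrow>
    (LINT s:{0..t}|lborel. \<bar>\<beta> s\<bar> * x s) \<le> K * (LINT s:{0..t}|lborel. \<bar>\<beta> s\<bar> * f s)"
    using gronwall_integral[OF abs\<beta>[of t] abs_ge_zero] by blast
  define G where "G s = (LINT q:{0..s}|lborel. \<bar>\<beta> q\<bar>)" for s
  \<comment> \<open>\<open>K\<close> is fixed by the horizon \<open>t\<close>, so \<open>w\<close> may be chosen after it.\<close>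
  obtain w where w: "u \<le> w" "w < t" "K * (G t - G w) < 1"
  proof -
    have "continuous_on {0..t} G"
      unfolding G_def by (rule continuous_on_indefinite_integral[OF abs\<beta>])
    hence "continuous_on {u..t} (\<lambda>s. K * (G t - G s))"
      by (intro continuous_intros) (rule continuous_on_subset, use ut in auto)
    hence "((\<lambda>s. K * (G t - G s)) \<longlongrightarrow> K * (G t - G t)) (at t within {u..t})"
      unfolding continuous_on_def by (rule bspec) (use ut in auto)
    hence "\<forall>\<^sub>F s in at t within {u..t}. K * (G t - G s) < 1"
      by (rule order_tendstoD) simp
    then obtain d where d: "0 < d" "\<And>s. s \<in> {u..t} \<Longrightarrow> s \<noteq> t \<Longrightarrow> dist s t < d \<Longrightarrow> K * (G t - G s) < 1"
      unfolding eventually_at by blast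
    show thesis
      by (rule that[of "max u (t - d / 2)"]) (use d ut in \<open>auto simp: dist_real_def intro!: d(2)\<close>)
  qed
  have w0: "0 \<le> w" using w ut by simp
  define N where "N \<omega> = W t \<omega> - W w \<omega>" for \<omega>
  have N: "square_integrable M N" "expectation N = 0"
    unfolding N_def[abs_def] using W_increment[of w t] w0 w by auto
  define g where "g s = (LINT q|lborel. indicator {w<..t} q * (indicator {0..s} q * r q))" for s
  define h where "h s = expectation (\<lambda>\<omega>. N \<omega> * Y s \<omega>)" for s
  have int: "integrable lborel (\<lambda>q. indicator {w<..t} q * (indicator {0..s} q * r q))" for s
    by (rule set_integrable_square_imp_integrable_indicator[OF r r_square])
  have g_zero: "g s = 0" if "s \<le> w" for s
  proof -
    have "(\<lambda>q. indicator {w<..t} q * (indicator {0..s} q * r q)) = (\<lambda>q. 0)"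
      using that by (auto simp: indicator_def)
    then show ?thesis unfolding g_def by (simp only: Bochner_Integration.integral_zero)
  qed
  have g_nonneg: "0 \<le> g s" for s
    unfolding g_def using r_pos w0
    by (intro integral_nonneg_AE) (auto elim!: eventually_mono simp: indicator_def)
  have g_le: "g s \<le> g t" if "s \<le> t" for s
    unfolding g_def using r_pos w0 that
    by (intro integral_mono_AE int) (auto elim!: eventually_mono simp: indicator_def)
  have g_pos: "0 < g t"
  proof (rule ccontr)
    assume "\<not> 0 < g t"
    hence "g t = 0" using g_nonneg[of t] by simp
    moreover have "AE q in lborel. 0 \<le> indicator {w<..t} q * (indicator {0..t} q * r q)"
      using r_pos w0 by (auto elim!: eventually_mono simp: indicator_def)
    ultimately have "AE q in lborel. indicator {w<..t} q * (indicator {0..t} q * r q) = 0"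
      unfolding g_def using integral_nonneg_eq_0_iff_AE[OF int[of t]] by simp
    hence "AE q in lborel. q \<notin> {w<..t}"
      using r_pos by eventually_elim (use w0 in \<open>auto simp: indicator_def split: if_splits\<close>)
    hence "emeasure lborel {w<..t} = 0" by (subst (asm) AE_iff_measurable[of "{w<..t}"]) auto
    then show False using w by simp
  qed
  have h_eq: "h s = g s + (LINT q:{0..s}|lborel. \<beta> q * h q)" if "0 \<le> s" for s
    using V.expectation_volterra(2)[OF N(1) that] f_cov[of w t s] w0 w that
    by (simp add: h_def g_def N_def)
  have h_int: "set_integrable lborel {0..s} (\<lambda>q. \<bar>\<beta> q\<bar> * \<bar>h q\<bar>)" for s
    using set_integrable_abs[OF V.expectation_volterra(1)[OF N(1), of s]]
    by (simp add: h_def abs_mult)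
  have h_int_le: "\<bar>LINT q:{0..s}|lborel. \<beta> q * h q\<bar> \<le> (LINT q:{0..s}|lborel. \<bar>\<beta> q\<bar> * \<bar>h q\<bar>)" for s
    unfolding set_lebesgue_integral_def by (rule order_trans[OF integral_abs_bound]) (simp add: abs_mult)
  have h_le: "\<bar>h s\<bar> \<le> g s + (LINT q:{0..s}|lborel. \<bar>\<beta> q\<bar> * \<bar>h q\<bar>)" if "0 \<le> s" for s
    using h_eq[OF that] h_int_le[of s] g_nonneg[of s] by linarith
  have g_meas [measurable]: "g \<in> borel_measurable borel"
  proof -
    have ind: "indicator {0..s} q = (if 0 \<le> q \<and> q \<le> s then 1 else (0::real))" for s q :: real
      by (simp add: indicator_def)
    have "(\<lambda>s. \<integral>q. indicator {w<..t} q * ((if 0 \<le> q \<and> q \<le> s then 1 else 0) * r q) \<partial>lborel) \<in> borel_measurable borel"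
      using r by (intro lborel.borel_measurable_lebesgue_integral) (simp add: case_prod_beta)
    then show ?thesis unfolding g_def[abs_def] ind .
  qed
  have g_int: "set_integrable lborel {0..s} (\<lambda>q. \<bar>\<beta> q\<bar> * g q)" if "s \<le> t" for s
  proof -
    have [measurable]: "\<beta> \<in> borel_measurable borel" by (rule V.\<beta>_measurable)
    show ?thesis
      unfolding set_integrable_def
    proof (rule Bochner_Integration.integrable_bound)
      show "integrable lborel (\<lambda>q. g t * (indicator {0..s} q *\<^sub>R \<bar>\<beta> q\<bar>))"
        using abs\<beta>[of s] by (simp add: set_integrable_def)
      show "AE q in lborel. norm (indicator {0..s} q *\<^sub>R (\<bar>\<beta> q\<bar> * g q)) \<le> norm (g t * (indicator {0..s} q *\<^sub>R \<bar>\<beta> q\<bar>))"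
      proof (intro AE_I2)
        fix q
        show "norm (indicator {0..s} q *\<^sub>R (\<bar>\<beta> q\<bar> * g q)) \<le> norm (g t * (indicator {0..s} q *\<^sub>R \<bar>\<beta> q\<bar>))"
          using mult_left_mono[OF g_le[of q], of "\<bar>\<beta> q\<bar>"] that g_nonneg
          by (auto simp: indicator_def abs_mult mult.commute)
      qed
    qed measurable
  qed
  have h_zero: "h s = 0" if s: "0 \<le> s" "s \<le> w" for s
  proof -
    obtain K' where K': "\<forall>x f. set_integrable lborel {0..s} (\<lambda>s. \<bar>\<beta> s\<bar> * x s) \<longrightarrow>
      set_integrable lborel {0..s} (\<lambda>s. \<bar>\<beta> s\<bar> * f s) \<longrightarrow>
      (\<forall>s\<in>{0..s}. 0 \<le> x s) \<longrightarrow> (\<forall>s\<in>{0..s}. 0 \<le> f s) \<longrightarrow>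
      (\<forall>s\<in>{0..s}. x s \<le> f s + (LINT r:{0..s}|lborel. \<bar>\<beta> r\<bar> * x r)) \<longrightarrow>
      (LINT s:{0..s}|lborel. \<bar>\<beta> s\<bar> * x s) \<le> K' * (LINT s:{0..s}|lborel. \<bar>\<beta> s\<bar> * f s)"
      using gronwall_integral[OF abs\<beta>[of s] abs_ge_zero] by blast
    have "(LINT q:{0..s}|lborel. \<bar>\<beta> q\<bar> * \<bar>h q\<bar>) \<le> K' * (LINT q:{0..s}|lborel. \<bar>\<beta> q\<bar> * 0)"
    proof (intro K'[rule_format] h_int)
      show "\<bar>h q\<bar> \<le> 0 + (LINT q:{0..q}|lborel. \<bar>\<beta> q\<bar> * \<bar>h q\<bar>)" if "q \<in> {0..s}" for q
        using h_le[of q] g_zero[of q] that s by simp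
    qed (auto simp: set_integrable_def)
    hence "(LINT q:{0..s}|lborel. \<bar>\<beta> q\<bar> * \<bar>h q\<bar>) \<le> 0" by (simp add: set_lebesgue_integral_def)
    then show ?thesis using h_le[OF s(1)] g_zero[OF s(2)] by simp
  qed
  have "(LINT q:{0..t}|lborel. \<bar>\<beta> q\<bar> * \<bar>h q\<bar>) \<le> K * (LINT q:{0..t}|lborel. \<bar>\<beta> q\<bar> * g q)"
    by (intro K[rule_format] h_int g_int h_le g_nonneg) auto
  also have "\<dots> \<le> K * (g t * (G t - G w))"
  proof (rule mult_left_mono[OF _ K0])
    have "(LINT q:{0..t}|lborel. \<bar>\<beta> q\<bar> * g q)
      = (LINT q:{0..w}|lborel. \<bar>\<beta> q\<bar> * g q) + (LINT q:{w<..t}|lborel. \<bar>\<beta> q\<bar> * g q)"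
      using set_integral_split[OF g_int[of t] w0] w by simp
    also have "(LINT q:{0..w}|lborel. \<bar>\<beta> q\<bar> * g q) = (LINT q:{0..w}|lborel. 0)"
      by (rule set_lebesgue_integral_cong) (auto simp: g_zero)
    also have "\<dots> = 0" by (simp add: set_lebesgue_integral_def)
    also have "(LINT q:{w<..t}|lborel. \<bar>\<beta> q\<bar> * g q) \<le> (LINT q:{w<..t}|lborel. g t * \<bar>\<beta> q\<bar>)"
    proof (rule set_integral_mono)
      show "set_integrable lborel {w<..t} (\<lambda>q. \<bar>\<beta> q\<bar> * g q)"
        by (rule set_integrable_subset[OF g_int[of t]]) (use w0 in auto)
      show "set_integrable lborel {w<..t} (\<lambda>q. g t * \<bar>\<beta> q\<bar>)"
        by (rule set_integrable_subset[OF set_integrable_mult_right[OF abs\<beta>[of t]]]) (use w0 in auto)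
      show "\<bar>\<beta> q\<bar> * g q \<le> g t * \<bar>\<beta> q\<bar>" if "q \<in> {w<..t}" for q
        using mult_left_mono[OF g_le[of q], of "\<bar>\<beta> q\<bar>"] that by (simp add: mult.commute)
    qed
    also have "\<dots> = g t * (LINT q:{w<..t}|lborel. \<bar>\<beta> q\<bar>)" by simp
    also have "(LINT q:{w<..t}|lborel. \<bar>\<beta> q\<bar>) = G t - G w"
      using set_integral_split[OF abs\<beta>[of t] w0] w by (simp add: G_def)
    finally show "(LINT q:{0..t}|lborel. \<bar>\<beta> q\<bar> * g q) \<le> g t * (G t - G w)" by simp
  qed
  also have "\<dots> = g t * (K * (G t - G w))" by (simp only: mult.left_commute)
  also have "\<dots> < g t * 1" by (rule mult_strict_left_mono[OF w(3) g_pos])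
  finally have "0 < h t" using h_eq[of t] h_int_le[of t] ut by simp
  then show thesis
    using that[OF N] h_zero w by (auto simp: h_def)
qed

end

lemma (in wiener) linear_sde_test_variable:
  assumes sde: "solves_linear_sde M W a b \<sigma> x0 X"
    and a_int: "\<And>T. 0 \<le> T \<Longrightarrow> a absolutely_integrable_on {0..T}"
    and b_int: "\<And>T. 0 \<le> T \<Longrightarrow> b absolutely_integrable_on {0..T}"
    and \<sigma>_int: "\<And>T. 0 \<le> T \<Longrightarrow> (\<lambda>t. (\<sigma> t)\<^sup>2) absolutely_integrable_on {0..T}"
    and \<sigma>_pos: "AE t in lebesgue. 0 \<le> t \<longrightarrow> 0 < \<sigma> t"
  shows "0 \<le> t \<Longrightarrow> square_integrable M (X t)"
    and "0 \<le> u \<Longrightarrow> u < t \<Longrightarrow> \<exists>N. square_integrable M N \<and> expectation N = 0 \<and>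
      (\<forall>s. 0 \<le> s \<longrightarrow> s \<le> u \<longrightarrow> expectation (\<lambda>\<omega>. N \<omega> * X s \<omega>) = 0) \<and> expectation (\<lambda>\<omega>. N \<omega> * X t \<omega>) \<noteq> 0"
proof -
  obtain Y \<beta> f r where V: "volterra M Y \<beta> f" and YX: "\<And>s. 0 \<le> s \<Longrightarrow> AE \<omega> in M. Y s \<omega> = X s \<omega>"
    and r: "r \<in> borel_measurable borel" "AE s in lborel. 0 \<le> s \<longrightarrow> 0 < r s"
      "\<And>T. set_integrable lborel {0..T} (\<lambda>s. (r s)\<^sup>2)"
    and f_cov: "\<And>u v t. 0 \<le> u \<Longrightarrow> u \<le> v \<Longrightarrow> 0 \<le> t \<Longrightarrow> expectation (\<lambda>\<omega>. (W v \<omega> - W u \<omega>) * f t \<omega>)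
       = (LINT s|lborel. indicator {u<..v} s * (indicator {0..t} s * r s))"
    using linear_sde_volterra[OF sde a_int b_int \<sigma>_int \<sigma>_pos] by blast
  interpret V: volterra M Y \<beta> f by (rule V)
  have X_meas: "X t \<in> borel_measurable M" if "0 \<le> t" for t
    using sde that by (simp add: solves_linear_sde_def)
  show "square_integrable M (X t)" if "0 \<le> t"
    by (rule square_integrable_cong_AE[OF V.Y_square[OF that] X_meas[OF that] YX[OF that]])
  have transfer: "expectation (\<lambda>\<omega>. N \<omega> * X s \<omega>) = expectation (\<lambda>\<omega>. N \<omega> * Y s \<omega>)"
    if N: "square_integrable M N" and s: "0 \<le> s" for N s
  proof (rule integral_cong_AE)
    show "(\<lambda>\<omega>. N \<omega> * X s \<omega>) \<in> borel_measurable M" "(\<lambda>\<omega>. N \<omega> * Y s \<omega>) \<in> borel_measurable M"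
      by (intro borel_measurable_times square_integrable_measurable[OF N] X_meas[OF s] V.Y_measurable)+
    show "AE \<omega> in M. N \<omega> * X s \<omega> = N \<omega> * Y s \<omega>"
      using YX[OF s] by eventually_elim simp
  qed
  show "\<exists>N. square_integrable M N \<and> expectation N = 0 \<and>
      (\<forall>s. 0 \<le> s \<longrightarrow> s \<le> u \<longrightarrow> expectation (\<lambda>\<omega>. N \<omega> * X s \<omega>) = 0) \<and> expectation (\<lambda>\<omega>. N \<omega> * X t \<omega>) \<noteq> 0"
    if ut: "0 \<le> u" "u < t"
  proof -
    obtain N where N: "square_integrable M N" "expectation N = 0"
      "\<And>s. 0 \<le> s \<Longrightarrow> s \<le> u \<Longrightarrow> expectation (\<lambda>\<omega>. N \<omega> * Y s \<omega>) = 0"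
      "expectation (\<lambda>\<omega>. N \<omega> * Y t \<omega>) \<noteq> 0"
      using volterra_nondegenerate[OF V r f_cov ut] by blast
    then show ?thesis
      using transfer[OF N(1)] ut by (intro exI[of _ N]) auto
  qed
qed

text \<open>A vector in the kernel of the covariance gives a combination of the centred values that
  vanishes almost surely. Pairing it with the test variable that belongs to the last nonzero
  coefficient leaves only that coefficient.\<close>

lemma (in prob_space) covariance_nondegenerate:
  fixes X :: "real \<Rightarrow> 'a \<Rightarrow> real"
  assumes sq: "\<And>t. t \<in> J \<Longrightarrow> square_integrable M (X t)"
    and test: "\<And>u t. 0 \<le> u \<Longrightarrow> u < t \<Longrightarrow> \<exists>N. square_integrable M N \<and> expectation N = 0 \<and>
      (\<forall>s. 0 \<le> s \<longrightarrow> s \<le> u \<longrightarrow> expectation (\<lambda>\<omega>. N \<omega> * X s \<omega>) = 0) \<and> expectation (\<lambda>\<omega>. N \<omega> * X t \<omega>) \<noteq> 0"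
    and J: "finite J" "J \<subseteq> {0<..}"
  shows "gram M (\<lambda>t \<omega>. X t \<omega> - mean_fun M X t) J (cov_fun M X)"
    and "nondegenerate_on J (cov_fun M X)"
proof -
  define \<xi> where "\<xi> t \<omega> = X t \<omega> - mean_fun M X t" for t \<omega>
  have \<xi>_sq: "square_integrable M (\<xi> t)" if "t \<in> J" for t
    unfolding \<xi>_def[abs_def] by (intro square_integrable_diff sq square_integrable_const that)
  show g: "gram M (\<lambda>t \<omega>. X t \<omega> - mean_fun M X t) J (cov_fun M X)"
    unfolding \<xi>_def[symmetric]
    by unfold_locales (auto simp: J cov_fun_def \<xi>_def intro!: square_integrable_mult \<xi>_sq[unfolded \<xi>_def[abs_def]])
  show "nondegenerate_on J (cov_fun M X)"
    unfolding nondegenerate_on_def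
  proof (intro allI impI ballI, rule ccontr)
    fix x t
    assume x: "\<forall>s\<in>J. (\<Sum>t\<in>J. cov_fun M X s t * x t) = 0" and "t \<in> J"
    assume "x t \<noteq> 0"
    define A where "A = {s \<in> J. x s \<noteq> 0}"
    have A: "finite A" "A \<noteq> {}" using J \<open>x t \<noteq> 0\<close> \<open>t \<in> J\<close> by (auto simp: A_def)
    define t1 where "t1 = Max A"
    have t1: "t1 \<in> J" "x t1 \<noteq> 0" "0 < t1"
      using Max_in[OF A] J by (auto simp: t1_def A_def)
    have after: "x s = 0" if "s \<in> J" "t1 < s" for s
      using that Max_ge[OF A(1), of s] by (force simp: t1_def A_def)
    \<comment> \<open>All earlier times of \<open>J\<close> are at most \<open>u\<close>; the value \<open>0\<close> covers the case that there are none.\<close>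
    define u where "u = Max (insert 0 {s \<in> J. s < t1})"
    have fin: "finite (insert 0 {s \<in> J. s < t1})" using J by simp
    have u: "0 \<le> u" "\<And>s. s \<in> J \<Longrightarrow> s < t1 \<Longrightarrow> s \<le> u"
      unfolding u_def using Max_ge[OF fin] by auto
    have "u < t1" unfolding u_def using fin t1 by (subst Max_less_iff) auto
    from test[OF u(1) this] obtain N where N: "square_integrable M N" "expectation N = 0"
      "\<And>s. 0 \<le> s \<Longrightarrow> s \<le> u \<Longrightarrow> expectation (\<lambda>\<omega>. N \<omega> * X s \<omega>) = 0" "expectation (\<lambda>\<omega>. N \<omega> * X t1 \<omega>) \<noteq> 0"
      by blast
    \<comment> \<open>Centring has no effect, because \<open>N\<close> has mean zero.\<close>
    have N\<xi>: "expectation (\<lambda>\<omega>. N \<omega> * \<xi> s \<omega>) = expectation (\<lambda>\<omega>. N \<omega> * X s \<omega>)" if "s \<in> J" for s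
      unfolding \<xi>_def right_diff_distrib
      using square_integrable_mult[OF N(1) sq[OF that]] square_integrable_integrable[OF N(1)] N(2) by simp
    define Z where "Z \<omega> = (\<Sum>s\<in>J. x s * \<xi> s \<omega>)" for \<omega>
    have Z_sq: "square_integrable M Z"
      unfolding Z_def[abs_def] by (intro square_integrable_sum square_integrable_cmult \<xi>_sq)
    interpret gram M \<xi> J "cov_fun M X" using g unfolding \<xi>_def[symmetric] .
    have "expectation (\<lambda>\<omega>. (Z \<omega>)\<^sup>2) = bform J (cov_fun M X) x x"
      unfolding Z_def power2_eq_square by (rule expectation_comb_prod(1))
    also have "\<dots> = (\<Sum>s\<in>J. x s * (\<Sum>t\<in>J. cov_fun M X s t * x t))"
      by (simp add: bform_def sum_distrib_left mult_ac)
    also have "\<dots> = 0" using x by simp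
    finally have "expectation (\<lambda>\<omega>. (Z \<omega>)\<^sup>2) = 0" .
    hence "(expectation (\<lambda>\<omega>. N \<omega> * Z \<omega>))\<^sup>2 \<le> 0"
      using integral_Cauchy_Schwarz[OF N(1) Z_sq] by simp
    hence "0 = expectation (\<lambda>\<omega>. N \<omega> * Z \<omega>)" by simp
    also have "\<dots> = expectation (\<lambda>\<omega>. \<Sum>s\<in>J. x s * (N \<omega> * \<xi> s \<omega>))"
      by (simp add: Z_def sum_distrib_left mult_ac)
    also have "\<dots> = (\<Sum>s\<in>J. expectation (\<lambda>\<omega>. x s * (N \<omega> * \<xi> s \<omega>)))"
      by (intro Bochner_Integration.integral_sum integrable_mult_right square_integrable_mult N(1) \<xi>_sq)
    also have "\<dots> = (\<Sum>s\<in>J. if s = t1 then x s * expectation (\<lambda>\<omega>. N \<omega> * X s \<omega>) else 0)"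
    proof (rule sum.cong[OF refl])
      fix s assume s: "s \<in> J"
      consider "s < t1" | "s = t1" | "t1 < s" by linarith
      then show "expectation (\<lambda>\<omega>. x s * (N \<omega> * \<xi> s \<omega>)) = (if s = t1 then x s * expectation (\<lambda>\<omega>. N \<omega> * X s \<omega>) else 0)"
        using N\<xi>[OF s] N(3)[of s] u(2)[OF s] after[OF s] J s by cases force+
    qed
    also have "\<dots> = x t1 * expectation (\<lambda>\<omega>. N \<omega> * X t1 \<omega>)" using J t1 by simp
    finally show False using t1 N(4) by simp
  qed
qed

section \<open>Refining a design\<close>

lemma closure_feasible_designs:
  fixes \<tau> :: "real ^ 'n::{finite,linorder}"
  assumes "\<tau> \<in> closure (feasible_designs T\<^sub>l T\<^sub>u)"
  shows "\<tau> $ i \<in> {T\<^sub>l..T\<^sub>u}"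
proof -
  have "closed ((\<lambda>\<tau>. \<tau> $ i) -` {T\<^sub>l..T\<^sub>u} :: (real ^ 'n::{finite,linorder}) set)"
    by (intro closed_vimage continuous_intros)
  moreover have "feasible_designs T\<^sub>l T\<^sub>u \<subseteq> (\<lambda>\<tau>. \<tau> $ i) -` {T\<^sub>l..T\<^sub>u}"
    by (auto simp: feasible_designs_def)
  ultimately have "closure (feasible_designs T\<^sub>l T\<^sub>u) \<subseteq> (\<lambda>\<tau>. \<tau> $ i) -` {T\<^sub>l..T\<^sub>u}"
    by (rule closure_minimal[rotated])
  then show ?thesis using assms by blast
qed

text \<open>The \<open>i\<close>-th coordinate is the entry of the sorted set \<open>J\<close> whose position is the rank of \<open>i\<close>
  in its index type.\<close>

lemma feasible_design_with_times:
  assumes J: "finite J" "card J = CARD('n::{finite,linorder})" "J \<subseteq> {T\<^sub>l..T\<^sub>u}"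
  obtains \<tau> :: "real ^ 'n::{finite,linorder}"
  where "\<tau> \<in> feasible_designs T\<^sub>l T\<^sub>u" "range (vec_nth \<tau>) = J"
proof -
  define ts where "ts = sorted_list_of_set J"
  have ts: "set ts = J" "length ts = CARD('n)" "sorted_wrt (<) ts"
    using J by (auto simp: ts_def)
  define rk where "rk i = card {j::'n. j < i}" for i
  have rk_less: "rk i < rk j" if "i < j" for i j
    unfolding rk_def using that by (intro psubset_card_mono) auto
  have rk_bound: "rk i < length ts" for i
    unfolding rk_def ts(2) by (intro psubset_card_mono) auto
  define \<tau> :: "real ^ 'n::{finite,linorder}" where "\<tau> = (\<chi> i. ts ! rk i)"
  have mono: "strict_mono (vec_nth \<tau>)"
    unfolding strict_mono_def \<tau>_def using sorted_wrt_nth_less[OF ts(3)] rk_less rk_bound by simp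
  have sub: "range (vec_nth \<tau>) \<subseteq> J"
    using rk_bound ts(1) nth_mem by (fastforce simp: \<tau>_def)
  have "card (range (vec_nth \<tau>)) = card J"
    using J(2) strict_mono_imp_inj_on[OF mono] by (simp add: card_image)
  hence "range (vec_nth \<tau>) = J" using card_subset_eq[OF J(1) sub] by simp
  moreover have "\<tau> \<in> feasible_designs T\<^sub>l T\<^sub>u"
    using mono sub J(3) by (auto simp: feasible_designs_def subset_iff)
  ultimately show thesis by (rule that[rotated])
qed

lemma feasible_refinement:
  fixes \<tau>\<^sub>0 :: "real ^ 'n::{finite,linorder}"
  assumes "T\<^sub>l < T\<^sub>u" "\<tau>\<^sub>0 \<in> closure (feasible_designs T\<^sub>l T\<^sub>u)"
  obtains \<tau> :: "real ^ 'n::{finite,linorder}" where "\<tau> \<in> feasible_designs T\<^sub>l T\<^sub>u" "range (vec_nth \<tau>\<^sub>0) \<subseteq> range (vec_nth \<tau>)"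
proof -
  let ?J0 = "range (vec_nth \<tau>\<^sub>0)"
  have sub: "?J0 \<subseteq> {T\<^sub>l..T\<^sub>u}" using closure_feasible_designs[OF assms(2)] by blast
  have "infinite ({T\<^sub>l..T\<^sub>u} - ?J0)" using assms(1) by (simp add: infinite_Icc)
  then obtain B where B: "finite B" "card B = CARD('n) - card ?J0" "B \<subseteq> {T\<^sub>l..T\<^sub>u} - ?J0"
    using infinite_arbitrarily_large by blast
  have "card (?J0 \<union> B) = card ?J0 + card B" by (rule card_Un_disjoint) (use B in auto)
  also have "\<dots> = CARD('n)" using card_image_le[of UNIV "vec_nth \<tau>\<^sub>0"] B(2) by simp
  finally have "card (?J0 \<union> B) = CARD('n)" .
  moreover have "finite (?J0 \<union> B)" "?J0 \<union> B \<subseteq> {T\<^sub>l..T\<^sub>u}" using B sub by auto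
  ultimately obtain \<tau> :: "real ^ 'n::{finite,linorder}" where "\<tau> \<in> feasible_designs T\<^sub>l T\<^sub>u" "range (vec_nth \<tau>) = ?J0 \<union> B"
    by (metis feasible_design_with_times)
  then show thesis using that by blast
qed

section \<open>Feasible designs dominate their limits\<close>

theorem theorem2:
  fixes M :: "'w measure"
    and W :: "real \<Rightarrow> 'w \<Rightarrow> real"
    and a :: "real ^ 'p::finite \<Rightarrow> real ^ 'q::finite \<Rightarrow> real \<Rightarrow> real \<Rightarrow> real"
    and b :: "real ^ 'q \<Rightarrow> real \<Rightarrow> real \<Rightarrow> real"
    and \<sigma> :: "real \<Rightarrow> real \<Rightarrow> real"
    and X :: "('p, 'q) parameter \<Rightarrow> real \<Rightarrow> 'w \<Rightarrow> real"
    and T\<^sub>l T\<^sub>u :: real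
    and \<theta>\<^sub>s :: "('p, 'q) parameter"
    and \<tau>\<^sub>0 :: "real ^ 'n::{finite,linorder}"
  assumes wiener: "wiener_process M W"
    and a_diff: "\<And>t \<theta>. 0 \<le> t \<Longrightarrow>
      (\<lambda>\<eta> :: ('p, 'q) parameter. a (par1 \<eta>) (par2 \<eta>) (par3 \<eta>) t) differentiable (at \<theta>)"
    and b_diff: "\<And>t \<theta>. 0 \<le> t \<Longrightarrow>
      (\<lambda>\<eta> :: ('p, 'q) parameter. b (par2 \<eta>) (par3 \<eta>) t) differentiable (at \<theta>)"
    and \<sigma>_diff: "\<And>t \<theta>. 0 \<le> t \<Longrightarrow>
      (\<lambda>\<eta> :: ('p, 'q) parameter. (\<sigma> (par3 \<eta>) t)\<^sup>2) differentiable (at \<theta>)"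
    and a_int: "\<And>x y z T. 0 \<le> T \<Longrightarrow> a x y z absolutely_integrable_on {0..T}"
    and b_int: "\<And>y z T. 0 \<le> T \<Longrightarrow> b y z absolutely_integrable_on {0..T}"
    and \<sigma>_int: "\<And>z T. 0 \<le> T \<Longrightarrow> (\<lambda>t. (\<sigma> z t)\<^sup>2) absolutely_integrable_on {0..T}"
    and \<sigma>_pos: "\<And>z. AE t in lebesgue. 0 \<le> t \<longrightarrow> 0 < \<sigma> z t"
    and sde: "\<And>\<theta>. solves_linear_sde M W
      (a (par1 \<theta>) (par2 \<theta>) (par3 \<theta>)) (b (par2 \<theta>) (par3 \<theta>)) (\<sigma> (par3 \<theta>)) (init \<theta>) (X \<theta>)"
    and times: "0 < T\<^sub>l" "T\<^sub>l < T\<^sub>u"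
    and size: "CARD(('p, 'q) component) \<le> CARD('n)"
    and \<tau>\<^sub>0: "\<tau>\<^sub>0 \<in> closure (feasible_designs T\<^sub>l T\<^sub>u)"
  shows "\<exists>\<tau> :: real ^ 'n::{finite,linorder}. \<tau> \<in> feasible_designs T\<^sub>l T\<^sub>u \<and>
    loewner_ge (fisher_information M X \<tau> \<theta>\<^sub>s) (fisher_information M X \<tau>\<^sub>0 \<theta>\<^sub>s)"
proof -
  interpret wiener M W
    using wiener by (simp add: wiener_def wiener_axioms_def wiener_process_def)
  note X = linear_sde_test_variable[OF sde[of \<theta>\<^sub>s] a_int b_int \<sigma>_int \<sigma>_pos]
  obtain \<tau> :: "real ^ 'n::{finite,linorder}" where \<tau>: "\<tau> \<in> feasible_designs T\<^sub>l T\<^sub>u" "range (vec_nth \<tau>\<^sub>0) \<subseteq> range (vec_nth \<tau>)"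
    using feasible_refinement[OF times(2) \<tau>\<^sub>0] by blast
  have pos: "range (vec_nth \<tau>) \<subseteq> {0<..}" using \<tau>(1) times(1)
    by (auto simp: feasible_designs_def intro: less_le_trans)
  have nondeg: "gram M (\<lambda>t \<omega>. X \<theta>\<^sub>s t \<omega> - mean_fun M (X \<theta>\<^sub>s) t) J (cov_fun M (X \<theta>\<^sub>s))"
      "nondegenerate_on J (cov_fun M (X \<theta>\<^sub>s))"
    if J: "finite J" "J \<subseteq> {0<..}" for J
  proof -
    have sq: "square_integrable M (X \<theta>\<^sub>s t)" if "t \<in> J" for t
      by (rule X(1)) (use J that in auto)
    show "gram M (\<lambda>t \<omega>. X \<theta>\<^sub>s t \<omega> - mean_fun M (X \<theta>\<^sub>s) t) J (cov_fun M (X \<theta>\<^sub>s))"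
      "nondegenerate_on J (cov_fun M (X \<theta>\<^sub>s))"
      using covariance_nondegenerate[OF sq X(2) J] by blast+
  qed
  have "loewner_ge (fisher_information M X \<tau> \<theta>\<^sub>s) (fisher_information M X \<tau>\<^sub>0 \<theta>\<^sub>s)"
    unfolding fisher_information_def
    using pos \<tau>(2) by (intro gaussian_information_monotone nondeg) (auto simp: design_times_def)
  with \<tau>(1) show ?thesis by blast
qed

end
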